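(* Let $K$ be an algebraically closed field of characteristic $p>0$ and let $A$ be a finite-dimensional $K$-algebra. Let $\{L(\lambda)\mid\lambda\in\Lambda\}$ be a complete set of pairwise non-isomorphic simple $A$-modules, with corresponding indecomposable projective modules $P(\lambda)$ (so $P(\lambda)$ is the projective cover of $L(\lambda)$). Let $G=Ae$ be a basic projective $A$-module, where $e$ is an idempotent of $A$, and let $t:A\text{-}\mathrm{mod}\to A\text{-}\mathrm{mod}$ be the additive functor $M\mapsto AeM$, $\theta\mapsto\theta|_{t(M)}$. Suppose $\Lambda'$ is a subset of $\Lambda$ such that $\operatorname{soc}P(\lambda)=Ae\operatorname{soc}P(\lambda)$ for all $\lambda\in\Lambda'$. Put $P=\bigoplus_{\lambda\in\Lambda'}P(\lambda)$. Then $$t:\operatorname{End}_A(P)\to\operatorname{End}_A(t(P))$$ is an injective algebra homomorphism.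
   Context: $A\text{-}\mathrm{mod}$ is the category of finite-dimensional left $A$-modules. For a module $M$, $t(M)=AeM$ is the submodule of $M$ generated by $eM$; it is the largest submodule of $M$ generated by $G=Ae$ (a module is generated by $G$ if it is isomorphic to a quotient of a direct sum of copies of $G$). For a homomorphism $\theta:M\to N$, $t(\theta)$ is the restriction $\theta|_{t(M)}:t(M)\to t(N)$. $\operatorname{soc}$ denotes the socle. *)

theory Defs
  imports "HOL-Algebra.Algebra"
begin

text \<open>
  The library's locales \<^locale>\<open>module\<close> and \<^locale>\<open>algebra\<close> require a commutative ring of scalars,
  respectively a commutative algebra, so the noncommutative versions are set up here. They reuse the
  record \<^type>\<open>module\<close> and the locale \<^locale>\<open>submodule\<close>, which do not ask for commutativity. When such
  a record is used as a module, its fields \<open>mult\<close> and \<open>one\<close> carry no information.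
\<close>

section \<open>Algebras and modules\<close>

definition ring_char :: "('k, 'z) ring_scheme \<Rightarrow> nat" where
  \<comment> \<open>\<open>group.ord\<close> is \<open>0\<close> for an element of infinite order\<close>
  "ring_char R = group.ord (add_monoid R) \<one>\<^bsub>R\<^esub>"

locale assoc_algebra = module K A + ring A
  for K :: "'k ring" (structure) and A :: "('k, 'a) module" (structure) +
  assumes smult_mult_left:
      "\<lbrakk>k \<in> carrier K; x \<in> carrier A; y \<in> carrier A\<rbrakk> \<Longrightarrow>
        (k \<odot>\<^bsub>A\<^esub> x) \<otimes>\<^bsub>A\<^esub> y = k \<odot>\<^bsub>A\<^esub> (x \<otimes>\<^bsub>A\<^esub> y)"
    and smult_mult_right:
      "\<lbrakk>k \<in> carrier K; x \<in> carrier A; y \<in> carrier A\<rbrakk> \<Longrightarrow>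
        x \<otimes>\<^bsub>A\<^esub> (k \<odot>\<^bsub>A\<^esub> y) = k \<odot>\<^bsub>A\<^esub> (x \<otimes>\<^bsub>A\<^esub> y)"

locale assoc_algebra_hom =
  S?: assoc_algebra K S + T?: assoc_algebra K T 
  for K :: "'k ring" (structure) and S :: "('k, 'a) module" (structure)
    and T :: "('k, 'b) module" (structure) +
  fixes h :: "'a \<Rightarrow> 'b"
  assumes hom_ring: "h \<in> ring_hom S T"
    and hom_smult: "\<lbrakk>k \<in> carrier K; x \<in> carrier S\<rbrakk> \<Longrightarrow> h (k \<odot>\<^bsub>S\<^esub> x) = k \<odot>\<^bsub>T\<^esub> h x"

locale left_module = A?: ring A + M?: abelian_group M
  for A :: "('a, 'z) ring_scheme" (structure) and M :: "('a, 'm) module" (structure) +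
  assumes smult_closed [simp, intro]:
      "\<lbrakk>a \<in> carrier A; x \<in> carrier M\<rbrakk> \<Longrightarrow> a \<odot>\<^bsub>M\<^esub> x \<in> carrier M"
    and smult_l_distr:
      "\<lbrakk>a \<in> carrier A; b \<in> carrier A; x \<in> carrier M\<rbrakk> \<Longrightarrow>
        (a \<oplus>\<^bsub>A\<^esub> b) \<odot>\<^bsub>M\<^esub> x = a \<odot>\<^bsub>M\<^esub> x \<oplus>\<^bsub>M\<^esub> b \<odot>\<^bsub>M\<^esub> x"
    and smult_r_distr:
      "\<lbrakk>a \<in> carrier A; x \<in> carrier M; y \<in> carrier M\<rbrakk> \<Longrightarrow>
        a \<odot>\<^bsub>M\<^esub> (x \<oplus>\<^bsub>M\<^esub> y) = a \<odot>\<^bsub>M\<^esub> x \<oplus>\<^bsub>M\<^esub> a \<odot>\<^bsub>M\<^esub> y"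
    and smult_assoc:
      "\<lbrakk>a \<in> carrier A; b \<in> carrier A; x \<in> carrier M\<rbrakk> \<Longrightarrow>
        (a \<otimes>\<^bsub>A\<^esub> b) \<odot>\<^bsub>M\<^esub> x = a \<odot>\<^bsub>M\<^esub> (b \<odot>\<^bsub>M\<^esub> x)"
    and smult_one [simp]: "x \<in> carrier M \<Longrightarrow> \<one>\<^bsub>A\<^esub> \<odot>\<^bsub>M\<^esub> x = x"

definition fin_dim :: "'k ring \<Rightarrow> ('k, 'v) module \<Rightarrow> bool" where
  "fin_dim K V \<longleftrightarrow> (\<exists>B. finite B \<and> B \<subseteq> carrier V \<and>
     (\<forall>v\<in>carrier V. \<exists>c\<in>B \<rightarrow> carrier K. v = (\<Oplus>\<^bsub>V\<^esub>b\<in>B. c b \<odot>\<^bsub>V\<^esub> b)))"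

definition restrict_scalars ::
    "('k, 'a) module \<Rightarrow> ('a, 'm) module \<Rightarrow> ('k, 'm) module" where
  \<comment> \<open>the \<open>K\<close>-space underlying an \<open>A\<close>-module, via \<open>k \<mapsto> k \<cdot> 1\<close> from \<open>K\<close> to \<open>A\<close>\<close>
  "restrict_scalars A M = \<lparr>carrier = carrier M, monoid.mult = monoid.mult M, one = one M,
     ring.zero = ring.zero M, ring.add = ring.add M, smult = (\<lambda>k x. (k \<odot>\<^bsub>A\<^esub> \<one>\<^bsub>A\<^esub>) \<odot>\<^bsub>M\<^esub> x)\<rparr>"

definition fd_module :: "'k ring \<Rightarrow> ('k, 'a) module \<Rightarrow> ('a, 'm) module \<Rightarrow> bool" where
  "fd_module K A M \<longleftrightarrow> left_module A M \<and> fin_dim K (restrict_scalars A M)"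

definition regular_module :: "('k, 'a) module \<Rightarrow> ('a, 'a) module" where
  "regular_module A = \<lparr>carrier = carrier A, monoid.mult = monoid.mult A, one = one A,
     ring.zero = ring.zero A, ring.add = ring.add A, smult = monoid.mult A\<rparr>"

definition left_ideal_module :: "('k, 'a) module \<Rightarrow> 'a \<Rightarrow> ('a, 'a) module" where
  \<comment> \<open>\<open>Ae\<close>\<close>
  "left_ideal_module A e = (regular_module A)\<lparr>carrier := (\<lambda>a. a \<otimes>\<^bsub>A\<^esub> e) ` carrier A\<rparr>"

definition lin_hom :: "('k, 'a) module \<Rightarrow> ('a, 'm) module \<Rightarrow> ('a, 'n) module \<Rightarrow> ('m \<Rightarrow> 'n) set" where
  \<comment> \<open>functions are \<open>undefined\<close> off the carrier, so that equality of functions is equality of morphisms\<close>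
  "lin_hom A M N = {h \<in> carrier M \<rightarrow>\<^sub>E carrier N.
     (\<forall>x\<in>carrier M. \<forall>y\<in>carrier M. h (x \<oplus>\<^bsub>M\<^esub> y) = h x \<oplus>\<^bsub>N\<^esub> h y) \<and>
     (\<forall>a\<in>carrier A. \<forall>x\<in>carrier M. h (a \<odot>\<^bsub>M\<^esub> x) = a \<odot>\<^bsub>N\<^esub> h x)}"

definition mod_iso :: "('k, 'a) module \<Rightarrow> ('a, 'm) module \<Rightarrow> ('a, 'n) module \<Rightarrow> bool" where
  "mod_iso A M N \<longleftrightarrow> (\<exists>h\<in>lin_hom A M N. bij_betw h (carrier M) (carrier N))"

definition End_alg :: "('k, 'a) module \<Rightarrow> ('a, 'm) module \<Rightarrow> ('k, 'm \<Rightarrow> 'm) module" where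
  "End_alg A M = \<lparr>carrier = lin_hom A M M,
     monoid.mult = (\<lambda>f g. compose (carrier M) f g),
     one = (\<lambda>x\<in>carrier M. x),
     ring.zero = (\<lambda>x\<in>carrier M. \<zero>\<^bsub>M\<^esub>),
     ring.add = (\<lambda>f g. \<lambda>x\<in>carrier M. f x \<oplus>\<^bsub>M\<^esub> g x),
     smult = (\<lambda>k f. \<lambda>x\<in>carrier M. (k \<odot>\<^bsub>A\<^esub> \<one>\<^bsub>A\<^esub>) \<odot>\<^bsub>M\<^esub> f x)\<rparr>"

definition submodule_gen :: "('k, 'a) module \<Rightarrow> ('a, 'm) module \<Rightarrow> 'm set \<Rightarrow> 'm set" where
  "submodule_gen A M S = \<Inter>{N. submodule N A M \<and> S \<subseteq> N}"

definition direct_sum :: "'i set \<Rightarrow> ('i \<Rightarrow> ('a, 'm) module) \<Rightarrow> ('a, 'i \<Rightarrow> 'm) module" where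
  "direct_sum I M = \<lparr>carrier = {f \<in> (\<Pi>\<^sub>E i\<in>I. carrier (M i)). finite {i \<in> I. f i \<noteq> \<zero>\<^bsub>M i\<^esub>}},
     monoid.mult = undefined, one = undefined,
     ring.zero = (\<lambda>i\<in>I. \<zero>\<^bsub>M i\<^esub>),
     ring.add = (\<lambda>f g. \<lambda>i\<in>I. f i \<oplus>\<^bsub>M i\<^esub> g i),
     smult = (\<lambda>a f. \<lambda>i\<in>I. a \<odot>\<^bsub>M i\<^esub> f i)\<rparr>"


section \<open>Simple, indecomposable, basic and projective modules\<close>

definition simple_module :: "('k, 'a) module \<Rightarrow> ('a, 'm) module \<Rightarrow> bool" where
  "simple_module A M \<longleftrightarrow> left_module A M \<and> carrier M \<noteq> {\<zero>\<^bsub>M\<^esub>} \<and>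
     (\<forall>N. submodule N A M \<longrightarrow> N = {\<zero>\<^bsub>M\<^esub>} \<or> N = carrier M)"

definition soc :: "('k, 'a) module \<Rightarrow> ('a, 'm) module \<Rightarrow> ('a, 'm) module" where
  "soc A M = M\<lparr>carrier := submodule_gen A M
     (\<Union>{S. submodule S A M \<and> simple_module A (M\<lparr>carrier := S\<rparr>)})\<rparr>"

definition indecomposable :: "('k, 'a) module \<Rightarrow> ('a, 'm) module \<Rightarrow> bool" where
  "indecomposable A M \<longleftrightarrow> left_module A M \<and> carrier M \<noteq> {\<zero>\<^bsub>M\<^esub>} \<and>
     (\<forall>U V. submodule U A M \<and> submodule V A M \<and> U \<inter> V = {\<zero>\<^bsub>M\<^esub>} \<and> U <+>\<^bsub>M\<^esub> V = carrier M
       \<longrightarrow> U = {\<zero>\<^bsub>M\<^esub>} \<or> V = {\<zero>\<^bsub>M\<^esub>})"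

definition basic_module :: "('k, 'a) module \<Rightarrow> ('a, 'm) module \<Rightarrow> bool" where
  \<comment> \<open>\<open>M\<close> is the internal direct sum of finitely many pairwise non-isomorphic indecomposable
    submodules; the summands are nonzero, hence distinct, so they may be indexed by themselves\<close>
  "basic_module A M \<longleftrightarrow> left_module A M \<and> (\<exists>\<U>. finite \<U> \<and>
     (\<forall>U\<in>\<U>. submodule U A M \<and> indecomposable A (M\<lparr>carrier := U\<rparr>)) \<and>
     (\<forall>U\<in>\<U>. \<forall>V\<in>\<U>. U \<noteq> V \<longrightarrow> \<not> mod_iso A (M\<lparr>carrier := U\<rparr>) (M\<lparr>carrier := V\<rparr>)) \<and>
     bij_betw (\<lambda>f. \<Oplus>\<^bsub>M\<^esub>U\<in>\<U>. f U) (\<Pi>\<^sub>E U\<in>\<U>. U) (carrier M))"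

text \<open>
  HOL cannot quantify over all modules inside a formula, only over those with elements in one given
  type. The type \<open>nat \<Rightarrow> 'k\<close>, where \<open>'k\<close> is the type of scalars, loses nothing: by
  \<open>fd_module_copy\<close> below, every finite-dimensional module is isomorphic to one with elements in it.
\<close>

definition complete_simples ::
    "'k ring \<Rightarrow> ('k, 'a) module \<Rightarrow> 'l set \<Rightarrow> ('l \<Rightarrow> ('a, 'm) module) \<Rightarrow> bool" where
  "complete_simples K A \<Lambda> L \<longleftrightarrow>
     (\<forall>i\<in>\<Lambda>. fd_module K A (L i) \<and> simple_module A (L i)) \<and>
     (\<forall>i\<in>\<Lambda>. \<forall>j\<in>\<Lambda>. i \<noteq> j \<longrightarrow> \<not> mod_iso A (L i) (L j)) \<and>
     (\<forall>S :: ('a, nat \<Rightarrow> 'k) module. fd_module K A S \<and> simple_module A S \<longrightarrow>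
        (\<exists>i\<in>\<Lambda>. mod_iso A S (L i)))"

definition projective :: "'k ring \<Rightarrow> ('k, 'a) module \<Rightarrow> ('a, 'm) module \<Rightarrow> bool" where
  "projective K A P \<longleftrightarrow> fd_module K A P \<and>
     (\<forall>(M :: ('a, nat \<Rightarrow> 'k) module) (N :: ('a, nat \<Rightarrow> 'k) module).
        \<forall>g\<in>lin_hom A M N. \<forall>h\<in>lin_hom A P N.
          fd_module K A M \<and> fd_module K A N \<and> g ` carrier M = carrier N \<longrightarrow>
          (\<exists>f\<in>lin_hom A P M. compose (carrier P) g f = h))"

definition projective_cover ::
    "'k ring \<Rightarrow> ('k, 'a) module \<Rightarrow> ('a, 'm) module \<Rightarrow> ('a, 'n) module \<Rightarrow> ('m \<Rightarrow> 'n) \<Rightarrow> bool" where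
  "projective_cover K A P M \<pi> \<longleftrightarrow> projective K A P \<and>
     \<pi> \<in> lin_hom A P M \<and> \<pi> ` carrier P = carrier M \<and>
     (\<forall>N. submodule N A P \<and> N <+>\<^bsub>P\<^esub> a_kernel P M \<pi> = carrier P \<longrightarrow> N = carrier P)"


section \<open>The functor \<open>M \<mapsto> AeM\<close>\<close>

definition t_obj :: "('k, 'a) module \<Rightarrow> 'a \<Rightarrow> ('a, 'm) module \<Rightarrow> ('a, 'm) module" where
  "t_obj A e M = M\<lparr>carrier := submodule_gen A M ((\<lambda>x. e \<odot>\<^bsub>M\<^esub> x) ` carrier M)\<rparr>"

definition t_mor ::
    "('k, 'a) module \<Rightarrow> 'a \<Rightarrow> ('a, 'm) module \<Rightarrow> ('m \<Rightarrow> 'n) \<Rightarrow> ('m \<Rightarrow> 'n)" where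
  \<comment> \<open>the module argument is the domain of \<open>\<theta>\<close>\<close>
  "t_mor A e M \<theta> = restrict \<theta> (carrier (t_obj A e M))"


section \<open>Finite-dimensional modules up to isomorphism\<close>

lemma restrict_scalars_simps [simp]:
  "carrier (restrict_scalars A M) = carrier M"
  "finsum (restrict_scalars A M) = finsum M"
  "k \<odot>\<^bsub>restrict_scalars A M\<^esub> x = (k \<odot>\<^bsub>A\<^esub> \<one>\<^bsub>A\<^esub>) \<odot>\<^bsub>M\<^esub> x"
  by (simp_all add: restrict_scalars_def finsum_def finprod_def fun_eq_iff)

lemma fd_module_copy:
  fixes K :: "'k ring" and A :: "('k, 'a) module" and M :: "('a, 'm) module"
  assumes alg: "assoc_algebra K A" and fd: "fd_module K A M"
  shows "\<exists>N :: ('a, nat \<Rightarrow> 'k) module. fd_module K A N \<and> mod_iso A M N"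
proof -
  interpret A: assoc_algebra K A by (rule alg)
  interpret M: left_module A M using fd by (simp add: fd_module_def)
  obtain B where B: "finite B" "B \<subseteq> carrier M" and
    span: "\<And>v. v \<in> carrier M \<Longrightarrow> \<exists>c\<in>B \<rightarrow> carrier K.
      v = (\<Oplus>\<^bsub>M\<^esub>b\<in>B. (c b \<odot>\<^bsub>A\<^esub> \<one>\<^bsub>A\<^esub>) \<odot>\<^bsub>M\<^esub> b)"
    using fd by (auto simp: fd_module_def fin_dim_def)
  define cf where "cf v = (SOME c. c \<in> B \<rightarrow> carrier K \<and>
      v = (\<Oplus>\<^bsub>M\<^esub>b\<in>B. (c b \<odot>\<^bsub>A\<^esub> \<one>\<^bsub>A\<^esub>) \<odot>\<^bsub>M\<^esub> b))" for v
  have cf: "cf v \<in> B \<rightarrow> carrier K" "v = (\<Oplus>\<^bsub>M\<^esub>b\<in>B. (cf v b \<odot>\<^bsub>A\<^esub> \<one>\<^bsub>A\<^esub>) \<odot>\<^bsub>M\<^esub> b)"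
    if "v \<in> carrier M" for v
    using someI_ex[OF span[OF that, unfolded Bex_def]] unfolding cf_def by auto
  obtain g :: "'m \<Rightarrow> nat" where g: "inj_on g B"
    using B(1) finite_imp_inj_to_nat_seg by blast
  define \<phi> where "\<phi> v = (\<lambda>n. cf v (inv_into B g n))" for v
  have inj: "inj_on \<phi> (carrier M)"
  proof (rule inj_onI)
    fix x y assume xy: "x \<in> carrier M" "y \<in> carrier M" "\<phi> x = \<phi> y"
    have eq: "cf x b = cf y b" if "b \<in> B" for b
      using fun_cong[OF xy(3), of "g b"] that g by (simp add: \<phi>_def)
    have "(\<Oplus>\<^bsub>M\<^esub>b\<in>B. (cf x b \<odot>\<^bsub>A\<^esub> \<one>\<^bsub>A\<^esub>) \<odot>\<^bsub>M\<^esub> b) = (\<Oplus>\<^bsub>M\<^esub>b\<in>B. (cf y b \<odot>\<^bsub>A\<^esub> \<one>\<^bsub>A\<^esub>) \<odot>\<^bsub>M\<^esub> b)"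
      using B cf(1)[OF xy(2)] by (intro M.finsum_cong') (auto simp: eq Pi_def subset_iff)
    then show "x = y"
      by (rule trans[OF cf(2)[OF xy(1)] trans[OF _ cf(2)[OF xy(2), symmetric]]])
  qed
  define \<psi> where "\<psi> = the_inv_into (carrier M) \<phi>"
  have \<psi>[simp]: "\<psi> (\<phi> x) = x" if "x \<in> carrier M" for x
    using that inj by (simp add: \<psi>_def the_inv_into_f_f)
  define N :: "('a, nat \<Rightarrow> 'k) module" where
    "N = \<lparr>carrier = \<phi> ` carrier M, monoid.mult = undefined, one = undefined, ring.zero = \<phi> \<zero>\<^bsub>M\<^esub>,
      ring.add = (\<lambda>u v. \<phi> (\<psi> u \<oplus>\<^bsub>M\<^esub> \<psi> v)), smult = (\<lambda>a u. \<phi> (a \<odot>\<^bsub>M\<^esub> \<psi> u))\<rparr>"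
  have abN: "abelian_group N"
  proof (rule abelian_groupI)
    show "\<exists>y\<in>carrier N. y \<oplus>\<^bsub>N\<^esub> x = \<zero>\<^bsub>N\<^esub>" if "x \<in> carrier N" for x
    proof -
      obtain z where "z \<in> carrier M" "x = \<phi> z" using \<open>x \<in> carrier N\<close> by (auto simp: N_def)
      then show ?thesis
        by (intro bexI[of _ "\<phi> (\<ominus>\<^bsub>M\<^esub> z)"]) (auto simp: N_def M.l_neg)
    qed
  qed (auto simp: N_def M.a_ac)
  have lmN: "left_module A N"
    by (intro left_module.intro abN A.ring_axioms left_module_axioms.intro)
       (auto simp: N_def M.smult_l_distr M.smult_r_distr M.smult_assoc)
  interpret N: left_module A N by (rule lmN)
  have sum: "\<phi> (\<Oplus>\<^bsub>M\<^esub>b\<in>C. f b) = (\<Oplus>\<^bsub>N\<^esub>b\<in>C. \<phi> (f b))"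
    if "finite C" "f \<in> C \<rightarrow> carrier M" for f :: "'m \<Rightarrow> 'm" and C
    using that
  proof (induction C)
    case empty
    then show ?case by (simp add: N_def finsum_def finprod_def)
  next
    case (insert x C)
    have "(\<lambda>b. \<phi> (f b)) \<in> C \<rightarrow> carrier N" "\<phi> (f x) \<in> carrier N"
      using insert.prems by (auto simp: N_def)
    then have "(\<Oplus>\<^bsub>N\<^esub>b\<in>insert x C. \<phi> (f b)) = \<phi> (f x) \<oplus>\<^bsub>N\<^esub> \<phi> (\<Oplus>\<^bsub>M\<^esub>b\<in>C. f b)"
      using insert by (subst N.finsum_insert) auto
    also have "\<dots> = \<phi> (f x \<oplus>\<^bsub>M\<^esub> (\<Oplus>\<^bsub>M\<^esub>b\<in>C. f b))"
      using insert.prems by (simp add: N_def Pi_def)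
    finally show ?case using insert by (subst M.finsum_insert) auto
  qed
  have "\<exists>c\<in>\<phi> ` B \<rightarrow> carrier K. u = (\<Oplus>\<^bsub>N\<^esub>b\<in>\<phi> ` B. (c b \<odot>\<^bsub>A\<^esub> \<one>\<^bsub>A\<^esub>) \<odot>\<^bsub>N\<^esub> b)"
    if "u \<in> carrier N" for u
  proof -
    obtain v where v: "v \<in> carrier M" "u = \<phi> v" using \<open>u \<in> carrier N\<close> by (auto simp: N_def)
    have cl: "(\<lambda>b. (cf v b \<odot>\<^bsub>A\<^esub> \<one>\<^bsub>A\<^esub>) \<odot>\<^bsub>M\<^esub> b) \<in> B \<rightarrow> carrier M"
      using cf(1)[OF v(1)] B by (auto simp: Pi_def subset_iff)
    have im: "(\<lambda>u. (cf v (\<psi> u) \<odot>\<^bsub>A\<^esub> \<one>\<^bsub>A\<^esub>) \<odot>\<^bsub>N\<^esub> u) \<in> \<phi> ` B \<rightarrow> carrier N"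
      using cf(1)[OF v(1)] B by (auto simp: Pi_def subset_iff N_def)
    have "u = (\<Oplus>\<^bsub>N\<^esub>b\<in>B. \<phi> ((cf v b \<odot>\<^bsub>A\<^esub> \<one>\<^bsub>A\<^esub>) \<odot>\<^bsub>M\<^esub> b))"
      unfolding v(2) by (rule trans[OF arg_cong[OF cf(2)[OF v(1)], of \<phi>] sum[OF B(1) cl]])
    also have "\<dots> = (\<Oplus>\<^bsub>N\<^esub>b\<in>B. (cf v (\<psi> (\<phi> b)) \<odot>\<^bsub>A\<^esub> \<one>\<^bsub>A\<^esub>) \<odot>\<^bsub>N\<^esub> \<phi> b)"
      using im B by (intro N.finsum_cong') (auto simp: N_def subset_iff)
    also have "\<dots> = (\<Oplus>\<^bsub>N\<^esub>u\<in>\<phi> ` B. (cf v (\<psi> u) \<odot>\<^bsub>A\<^esub> \<one>\<^bsub>A\<^esub>) \<odot>\<^bsub>N\<^esub> u)"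
      using im inj B by (intro N.add.finprod_reindex[symmetric]) (auto intro: inj_on_subset)
    finally show ?thesis
      using cf(1)[OF v(1)] B by (intro bexI[of _ "\<lambda>u. cf v (\<psi> u)"]) (auto simp: subset_iff)
  qed
  then have "fin_dim K (restrict_scalars A N)"
    unfolding fin_dim_def using B
    by (intro exI[of _ "\<phi> ` B"]) (auto simp: N_def)
  moreover have "restrict \<phi> (carrier M) \<in> lin_hom A M N"
    by (auto simp: lin_hom_def N_def)
  moreover have "bij_betw (restrict \<phi> (carrier M)) (carrier M) (carrier N)"
    using inj by (auto simp: bij_betw_def N_def)
  ultimately show ?thesis
    using lmN unfolding fd_module_def mod_iso_def by blast
qed

end

theory Submission
  imports Defs
begin

text \<open>
  Suppose two homomorphisms into \<open>P(\<lambda>)\<close> agree on \<open>AeM\<close> but are different. The image of their difference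
  \<open>d\<close> is a nonzero submodule of the finite-dimensional module \<open>P(\<lambda>)\<close>, so it contains a simple
  submodule \<open>S\<close>. Since \<open>e d(M) = d(eM) = 0\<close>, also \<open>eS = 0\<close>. But \<open>S\<close> has a complement \<open>C\<close> in the socle, so
  \<open>e soc P(\<lambda>) = eC\<close> lies in \<open>C\<close> and cannot generate the socle, contrary to the hypothesis. Injectivity
  for the direct sum follows componentwise.
\<close>

section \<open>Submodules\<close>

text \<open>The direct sum is not shown to be finite-dimensional, so two homomorphisms are compared
  with an arbitrary source and a finite-dimensional target. Finite dimension serves to produce a
  simple submodule: this takes a natural number attached to submodules that grows strictly with
  them, and \<open>pivot_count\<close> plays that part in place of a dimension. The complement in
  the socle comes from Zorn's lemma, applied to the submodules that meet S in zero; no decomposition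
  of the socle into simple summands is constructed, and the complement found need not itself lie in
  the socle. That \<open>t_mor\<close> is an algebra homomorphism is a separate, formal matter:
  h(ex) = e h(x), so homomorphisms carry AeM into AeN, and the operations on endomorphisms are
  pointwise.\<close>

context left_module
begin

lemma zero_smult: "x \<in> carrier M \<Longrightarrow> \<zero>\<^bsub>A\<^esub> \<odot>\<^bsub>M\<^esub> x = \<zero>\<^bsub>M\<^esub>"
  using smult_l_distr[of "\<zero>\<^bsub>A\<^esub>" "\<zero>\<^bsub>A\<^esub>" x] by (simp add: M.add.l_cancel_one')

lemma smult_zero: "a \<in> carrier A \<Longrightarrow> a \<odot>\<^bsub>M\<^esub> \<zero>\<^bsub>M\<^esub> = \<zero>\<^bsub>M\<^esub>"
  using smult_r_distr[of a "\<zero>\<^bsub>M\<^esub>" "\<zero>\<^bsub>M\<^esub>"] by (simp add: M.add.l_cancel_one')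

lemma uminus_one_smult: "x \<in> carrier M \<Longrightarrow> (\<ominus>\<^bsub>A\<^esub> \<one>\<^bsub>A\<^esub>) \<odot>\<^bsub>M\<^esub> x = \<ominus>\<^bsub>M\<^esub> x"
  using smult_l_distr[of "\<ominus>\<^bsub>A\<^esub> \<one>\<^bsub>A\<^esub>" "\<one>\<^bsub>A\<^esub>" x]
  by (simp add: zero_smult A.l_neg M.minus_equality)

text \<open>Additive inverses are multiplication by the scalar -1, so closure under the action
  already gives the subgroup condition contained in \<open>submodule\<close>.\<close>

lemma submodule_iff:
  "submodule H A M \<longleftrightarrow> H \<subseteq> carrier M \<and> \<zero>\<^bsub>M\<^esub> \<in> H \<and>
     (\<forall>x\<in>H. \<forall>y\<in>H. x \<oplus>\<^bsub>M\<^esub> y \<in> H) \<and> (\<forall>a\<in>carrier A. \<forall>x\<in>H. a \<odot>\<^bsub>M\<^esub> x \<in> H)"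
  (is "_ \<longleftrightarrow> ?R")
proof
  assume "submodule H A M"
  then interpret H: submodule H A M .
  show ?R
    using H.subset H.m_closed H.one_closed by auto
next
  assume R: ?R
  have "inv\<^bsub>add_monoid M\<^esub> x \<in> H" if "x \<in> H" for x
  proof -
    have "\<ominus>\<^bsub>M\<^esub> x = (\<ominus>\<^bsub>A\<^esub> \<one>\<^bsub>A\<^esub>) \<odot>\<^bsub>M\<^esub> x"
      using R \<open>x \<in> H\<close> by (subst uminus_one_smult) auto
    also have "\<dots> \<in> H"
      using R \<open>x \<in> H\<close> by simp
    finally show ?thesis
      by (simp add: a_inv_def)
  qed
  with R show "submodule H A M"
    by (intro submodule.intro subgroup.intro submodule_axioms.intro) auto
qed

lemma submodule_minus_closed:
  assumes "submodule H A M" "x \<in> H" "y \<in> H"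
  shows "x \<ominus>\<^bsub>M\<^esub> y \<in> H"
proof -
  have "x \<ominus>\<^bsub>M\<^esub> y = x \<oplus>\<^bsub>M\<^esub> (\<ominus>\<^bsub>A\<^esub> \<one>\<^bsub>A\<^esub>) \<odot>\<^bsub>M\<^esub> y"
    using assms by (subst uminus_one_smult) (auto simp: submodule_iff a_minus_def)
  then show ?thesis
    using assms by (simp add: submodule_iff)
qed

lemma left_module_submodule:
  assumes "submodule H A M"
  shows "left_module A (M\<lparr>carrier := H\<rparr>)"
proof -
  have H: "H \<subseteq> carrier M" "\<zero>\<^bsub>M\<^esub> \<in> H" "\<And>x y. x \<in> H \<Longrightarrow> y \<in> H \<Longrightarrow> x \<oplus>\<^bsub>M\<^esub> y \<in> H"
    "\<And>a x. a \<in> carrier A \<Longrightarrow> x \<in> H \<Longrightarrow> a \<odot>\<^bsub>M\<^esub> x \<in> H"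
    using assms by (auto simp: submodule_iff)
  have "abelian_group (M\<lparr>carrier := H\<rparr>)"
  proof (rule abelian_groupI)
    show "\<exists>y\<in>carrier (M\<lparr>carrier := H\<rparr>). y \<oplus>\<^bsub>M\<lparr>carrier := H\<rparr>\<^esub> x = \<zero>\<^bsub>M\<lparr>carrier := H\<rparr>\<^esub>"
      if "x \<in> carrier (M\<lparr>carrier := H\<rparr>)" for x
      using that H(1) H(4)[of "\<ominus>\<^bsub>A\<^esub> \<one>\<^bsub>A\<^esub>" x]
      by (intro bexI[of _ "\<ominus>\<^bsub>M\<^esub> x"]) (auto simp: uminus_one_smult M.l_neg subset_iff)
  qed (use H in \<open>auto simp: M.a_ac subset_iff\<close>)
  then show ?thesis
    using H(1,4)
    by (intro left_module.intro A.ring_axioms left_module_axioms.intro)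
       (auto simp: smult_l_distr smult_r_distr smult_assoc subset_iff)
qed

text \<open>Changing the carrier leaves zero, addition and action untouched, so questions about
  submodules of \<open>H\<close> can be moved to the ambient module.\<close>

lemma submodule_submodule_iff:
  assumes "submodule H A M"
  shows "submodule N A (M\<lparr>carrier := H\<rparr>) \<longleftrightarrow> submodule N A M \<and> N \<subseteq> H"
proof -
  interpret H: left_module A "M\<lparr>carrier := H\<rparr>"
    using assms by (rule left_module_submodule)
  show ?thesis
    using assms by (simp add: H.submodule_iff submodule_iff) blast
qed

lemma submodule_Int: "submodule H A M \<Longrightarrow> submodule N A M \<Longrightarrow> submodule (H \<inter> N) A M"
  by (auto simp: submodule_iff)

lemma submodule_singleton_zero: "submodule {\<zero>\<^bsub>M\<^esub>} A M"
  by (auto simp: submodule_iff smult_zero)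

lemma submodule_set_add:
  assumes H: "submodule H A M" and N: "submodule N A M"
  shows "submodule (H <+>\<^bsub>M\<^esub> N) A M" "H \<subseteq> H <+>\<^bsub>M\<^esub> N" "N \<subseteq> H <+>\<^bsub>M\<^esub> N"
proof -
  have sub: "H \<subseteq> carrier M" "N \<subseteq> carrier M"
    and closed: "\<And>x y. x \<in> H \<Longrightarrow> y \<in> H \<Longrightarrow> x \<oplus>\<^bsub>M\<^esub> y \<in> H"
      "\<And>x y. x \<in> N \<Longrightarrow> y \<in> N \<Longrightarrow> x \<oplus>\<^bsub>M\<^esub> y \<in> N"
      "\<And>a x. a \<in> carrier A \<Longrightarrow> x \<in> H \<Longrightarrow> a \<odot>\<^bsub>M\<^esub> x \<in> H"
      "\<And>a x. a \<in> carrier A \<Longrightarrow> x \<in> N \<Longrightarrow> a \<odot>\<^bsub>M\<^esub> x \<in> N"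
    and zero: "\<zero>\<^bsub>M\<^esub> \<in> H" "\<zero>\<^bsub>M\<^esub> \<in> N"
    using H N by (auto simp: submodule_iff)
  have mem: "z \<in> H <+>\<^bsub>M\<^esub> N \<longleftrightarrow> (\<exists>x\<in>H. \<exists>y\<in>N. z = x \<oplus>\<^bsub>M\<^esub> y)" for z
    by (auto simp: set_add_def')
  show H': "H \<subseteq> H <+>\<^bsub>M\<^esub> N"
  proof
    fix x assume "x \<in> H"
    then show "x \<in> H <+>\<^bsub>M\<^esub> N"
      unfolding mem using sub zero by (intro bexI[of _ x] bexI[of _ "\<zero>\<^bsub>M\<^esub>"]) auto
  qed
  show N': "N \<subseteq> H <+>\<^bsub>M\<^esub> N"
  proof
    fix x assume "x \<in> N"
    then show "x \<in> H <+>\<^bsub>M\<^esub> N"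
      unfolding mem using sub zero by (intro bexI[of _ x] bexI[of _ "\<zero>\<^bsub>M\<^esub>"]) auto
  qed
  show "submodule (H <+>\<^bsub>M\<^esub> N) A M"
    unfolding submodule_iff
  proof (intro conjI ballI)
    fix u v assume "u \<in> H <+>\<^bsub>M\<^esub> N" "v \<in> H <+>\<^bsub>M\<^esub> N"
    then obtain x y x' y' where *: "x \<in> H" "y \<in> N" "u = x \<oplus>\<^bsub>M\<^esub> y" "x' \<in> H" "y' \<in> N"
        "v = x' \<oplus>\<^bsub>M\<^esub> y'"
      by (auto simp: mem)
    then have "u \<oplus>\<^bsub>M\<^esub> v = (x \<oplus>\<^bsub>M\<^esub> x') \<oplus>\<^bsub>M\<^esub> (y \<oplus>\<^bsub>M\<^esub> y')"
      using sub by (simp add: subset_iff M.a_ac)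
    then show "u \<oplus>\<^bsub>M\<^esub> v \<in> H <+>\<^bsub>M\<^esub> N"
      using * closed unfolding mem by blast
  next
    fix a u assume "a \<in> carrier A" "u \<in> H <+>\<^bsub>M\<^esub> N"
    then obtain x y where *: "a \<in> carrier A" "x \<in> H" "y \<in> N" "u = x \<oplus>\<^bsub>M\<^esub> y"
      by (auto simp: mem)
    then have "a \<odot>\<^bsub>M\<^esub> u = a \<odot>\<^bsub>M\<^esub> x \<oplus>\<^bsub>M\<^esub> a \<odot>\<^bsub>M\<^esub> y"
      using sub by (simp add: subset_iff smult_r_distr)
    then show "a \<odot>\<^bsub>M\<^esub> u \<in> H <+>\<^bsub>M\<^esub> N"
      using * closed unfolding mem by blast
  qed (use H' zero sub in \<open>auto simp: mem subset_iff\<close>)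
qed

end

section \<open>Simple submodules and complements\<close>

lemma simple_submodule_iff:
  assumes M: "left_module A M" and S: "submodule S A M"
  shows "simple_module A (M\<lparr>carrier := S\<rparr>) \<longleftrightarrow>
    S \<noteq> {\<zero>\<^bsub>M\<^esub>} \<and> (\<forall>N. submodule N A M \<and> N \<subseteq> S \<longrightarrow> N = {\<zero>\<^bsub>M\<^esub>} \<or> N = S)"
  using left_module.left_module_submodule[OF assms]
  by (simp add: simple_module_def left_module.submodule_submodule_iff[OF assms])

text \<open>Take C maximal among the submodules meeting S in zero. A simple T outside C + S would
  meet C + S in zero; then C + T would still meet S in zero and be larger than C. Since C + S
  contains every simple submodule, it contains the socle, which is all that is required of a
  complement here.\<close>

lemma complement_of_submodule:
  assumes M: "left_module A M" and S: "submodule S A M"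
  obtains C where "submodule C A M" "C \<inter> S = {\<zero>\<^bsub>M\<^esub>}"
    "\<And>T. submodule T A M \<Longrightarrow> simple_module A (M\<lparr>carrier := T\<rparr>) \<Longrightarrow> T \<subseteq> C <+>\<^bsub>M\<^esub> S"
proof -
  interpret left_module A M by (rule M)
  define F where "F = {C. submodule C A M \<and> C \<inter> S = {\<zero>\<^bsub>M\<^esub>}}"
  have "\<exists>C\<in>F. \<forall>U\<in>F. C \<subseteq> U \<longrightarrow> U = C"
  proof (rule subset_Zorn_nonempty)
    have "{\<zero>\<^bsub>M\<^esub>} \<in> F"
      using submodule_singleton_zero S by (auto simp: F_def submodule_iff)
    then show "F \<noteq> {}" by auto
  next
    fix \<C> assume ne: "\<C> \<noteq> {}" and ch: "subset.chain F \<C>"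
    then have sub: "submodule U A M" "U \<inter> S = {\<zero>\<^bsub>M\<^esub>}" if "U \<in> \<C>" for U
      using that by (auto simp: F_def subset.chain_def)
    have tot: "U \<subseteq> V \<or> V \<subseteq> U" if "U \<in> \<C>" "V \<in> \<C>" for U V
      using that ch by (auto simp: subset.chain_def)
    have "submodule (\<Union>\<C>) A M"
      unfolding submodule_iff
    proof (intro conjI ballI)
      fix x y assume "x \<in> \<Union>\<C>" "y \<in> \<Union>\<C>"
      then obtain U V where *: "U \<in> \<C>" "x \<in> U" "V \<in> \<C>" "y \<in> V" by auto
      \<comment> \<open>Of two members of a chain the larger one contains both elements, so their
        sum can be formed inside it.\<close>
      then obtain Q where "Q \<in> \<C>" "x \<in> Q" "y \<in> Q"
        using tot[of U V] by blast
      then show "x \<oplus>\<^bsub>M\<^esub> y \<in> \<Union>\<C>"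
        using sub(1)[of Q] by (auto simp: submodule_iff)
    next
      show "\<Union>\<C> \<subseteq> carrier M"
        using sub(1) by (fastforce simp: submodule_iff)
      show "\<zero>\<^bsub>M\<^esub> \<in> \<Union>\<C>"
        using ne sub(1) by (fastforce simp: submodule_iff)
      show "a \<odot>\<^bsub>M\<^esub> x \<in> \<Union>\<C>" if "a \<in> carrier A" "x \<in> \<Union>\<C>" for a x
        using that sub(1) by (fastforce simp: submodule_iff)
    qed
    then show "\<Union>\<C> \<in> F"
      using ne sub(2) by (auto simp: F_def)
  qed
  then obtain C where C: "submodule C A M" "C \<inter> S = {\<zero>\<^bsub>M\<^esub>}"
    and max: "\<And>U. submodule U A M \<Longrightarrow> U \<inter> S = {\<zero>\<^bsub>M\<^esub>} \<Longrightarrow> C \<subseteq> U \<Longrightarrow> U = C"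
    by (auto simp: F_def)
  note CS = submodule_set_add[OF C(1) S]
  have "T \<subseteq> C <+>\<^bsub>M\<^esub> S" if T: "submodule T A M" "simple_module A (M\<lparr>carrier := T\<rparr>)" for T
  proof (rule ccontr)
    assume not_sub: "\<not> T \<subseteq> C <+>\<^bsub>M\<^esub> S"
    \<comment> \<open>The intersection is a submodule of the simple T, hence zero or T, and T is
      excluded.\<close>
    have triv: "T \<inter> (C <+>\<^bsub>M\<^esub> S) = {\<zero>\<^bsub>M\<^esub>}"
      using T simple_submodule_iff[OF M T(1)] submodule_Int[OF T(1) CS(1)] not_sub by blast
    note CT = submodule_set_add[OF C(1) T(1)]
    have carr: "C \<subseteq> carrier M" "S \<subseteq> carrier M" "T \<subseteq> carrier M"
      and zero: "\<zero>\<^bsub>M\<^esub> \<in> C" "\<zero>\<^bsub>M\<^esub> \<in> S" "\<zero>\<^bsub>M\<^esub> \<in> T"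
      using C S T by (auto simp: submodule_iff)
    \<comment> \<open>If z = c + t lies in S, then t = z - c lies in both T and C + S, so t vanishes
      and z = c lies in the zero intersection of C and S.\<close>
    have "z = \<zero>\<^bsub>M\<^esub>" if z: "z \<in> C <+>\<^bsub>M\<^esub> T" "z \<in> S" for z
    proof -
      obtain c t where ct: "c \<in> C" "t \<in> T" "z = c \<oplus>\<^bsub>M\<^esub> t"
        using z(1) by (auto simp: set_add_def')
      then have "t = z \<ominus>\<^bsub>M\<^esub> c"
        using carr M.a_comm[of c t] by (simp add: subset_iff a_minus_def M.a_assoc M.r_neg)
      moreover have "z \<ominus>\<^bsub>M\<^esub> c \<in> C <+>\<^bsub>M\<^esub> S"
        using CS ct(1) z(2) by (intro submodule_minus_closed) auto
      ultimately have "t = \<zero>\<^bsub>M\<^esub>"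
        using triv ct(2) by auto
      then have "z = c"
        using ct carr by auto
      then show ?thesis
        using ct z(2) C(2) by auto
    qed
    then have "(C <+>\<^bsub>M\<^esub> T) \<inter> S = {\<zero>\<^bsub>M\<^esub>}"
      using CT(2) zero by auto
    then have "C <+>\<^bsub>M\<^esub> T = C"
      using CT by (intro max)
    then show False
      using CT(3) CS(2) not_sub by auto
  qed
  with C show thesis
    by (rule that)
qed

section \<open>Generated submodules and AeM\<close>

text \<open>Since \<open>S\<close> lies in the carrier, the whole module belongs to the family being
  intersected. For an empty family the intersection would be \<open>UNIV\<close>.\<close>

lemma submodule_submodule_gen:
  assumes "left_module A M" "S \<subseteq> carrier M"
  shows "submodule (submodule_gen A M S) A M"
proof -
  interpret left_module A M by (rule assms(1))
  have "submodule (carrier M) A M"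
    by (simp add: submodule_iff)
  then have "submodule_gen A M S \<subseteq> carrier M"
    using assms(2) by (auto simp: submodule_gen_def)
  moreover have "\<zero>\<^bsub>M\<^esub> \<in> N \<and> (\<forall>x\<in>N. \<forall>y\<in>N. x \<oplus>\<^bsub>M\<^esub> y \<in> N) \<and> (\<forall>a\<in>carrier A. \<forall>x\<in>N. a \<odot>\<^bsub>M\<^esub> x \<in> N)"
    if "submodule N A M" for N
    using that by (simp add: submodule_iff)
  ultimately show ?thesis
    by (subst submodule_iff) (simp add: submodule_gen_def)
qed

lemma submodule_gen_superset: "S \<subseteq> submodule_gen A M S"
  by (auto simp: submodule_gen_def)

lemma submodule_gen_least: "submodule N A M \<Longrightarrow> S \<subseteq> N \<Longrightarrow> submodule_gen A M S \<subseteq> N"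
  by (auto simp: submodule_gen_def)

lemma carrier_t_obj:
  "carrier (t_obj A e M) = submodule_gen A M ((\<lambda>x. e \<odot>\<^bsub>M\<^esub> x) ` carrier M)"
  by (simp add: t_obj_def)

lemma submodule_t_obj:
  assumes "left_module A M" "e \<in> carrier A"
  shows "submodule (carrier (t_obj A e M)) A M"
proof -
  interpret left_module A M by (rule assms(1))
  show ?thesis
    using assms unfolding carrier_t_obj by (intro submodule_submodule_gen) auto
qed

lemma smult_in_t_obj: "x \<in> carrier M \<Longrightarrow> e \<odot>\<^bsub>M\<^esub> x \<in> carrier (t_obj A e M)"
  unfolding carrier_t_obj by (rule subsetD[OF submodule_gen_superset]) simp

section \<open>The socle\<close>

lemma simple_submodule_subset_soc:
  assumes "submodule S A M" "simple_module A (M\<lparr>carrier := S\<rparr>)"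
  shows "S \<subseteq> carrier (soc A M)"
  using assms submodule_gen_superset[of "\<Union>{S. submodule S A M \<and> simple_module A (M\<lparr>carrier := S\<rparr>)}" A M]
  unfolding soc_def by (simp, blast)

text \<open>This turns a condition on the socle as a whole into one on each simple submodule, the
  form in which it can be applied to a simple submodule found inside an image.\<close>

lemma simple_submodule_not_annihilated:
  assumes M: "left_module A M" and e: "e \<in> carrier A"
    and soc: "soc A M = t_obj A e (soc A M)"
    and S: "submodule S A M" "simple_module A (M\<lparr>carrier := S\<rparr>)"
  shows "\<exists>x\<in>S. e \<odot>\<^bsub>M\<^esub> x \<noteq> \<zero>\<^bsub>M\<^esub>"
proof (rule ccontr)
  assume "\<not> (\<exists>x\<in>S. e \<odot>\<^bsub>M\<^esub> x \<noteq> \<zero>\<^bsub>M\<^esub>)"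
  then have ann: "e \<odot>\<^bsub>M\<^esub> x = \<zero>\<^bsub>M\<^esub>" if "x \<in> S" for x
    using that by auto
  interpret left_module A M by (rule M)
  define W where "W = carrier (soc A M)"
  have soc_W: "soc A M = M\<lparr>carrier := W\<rparr>"
    by (simp add: W_def soc_def)
  have W: "submodule W A M"
  proof -
    have "\<Union>{S. submodule S A M \<and> simple_module A (M\<lparr>carrier := S\<rparr>)} \<subseteq> carrier M"
      by (auto simp: submodule_iff)
    then show ?thesis
      unfolding W_def soc_def by (simp add: submodule_submodule_gen[OF M])
  qed
  obtain C where C: "submodule C A M" "C \<inter> S = {\<zero>\<^bsub>M\<^esub>}"
    "\<And>T. submodule T A M \<Longrightarrow> simple_module A (M\<lparr>carrier := T\<rparr>) \<Longrightarrow> T \<subseteq> C <+>\<^bsub>M\<^esub> S"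
    using complement_of_submodule[OF M S(1)] by blast
  have "W \<subseteq> C <+>\<^bsub>M\<^esub> S"
  proof -
    have "\<Union>{S. submodule S A M \<and> simple_module A (M\<lparr>carrier := S\<rparr>)} \<subseteq> C <+>\<^bsub>M\<^esub> S"
      using C(3) by blast
    then show ?thesis
      unfolding W_def soc_def by (simp add: submodule_gen_least[OF submodule_set_add(1)[OF C(1) S(1)]])
  qed
  \<comment> \<open>The summand in S is killed by e, so only the summand in C survives.\<close>
  moreover have "e \<odot>\<^bsub>M\<^esub> x \<in> C" if x: "x \<in> C <+>\<^bsub>M\<^esub> S" for x
  proof -
    obtain c s where "c \<in> C" "s \<in> S" "x = c \<oplus>\<^bsub>M\<^esub> s"
      using x by (auto simp: set_add_def')
    then show ?thesis
      using C(1) S(1) e ann[of s] by (auto simp: submodule_iff subset_iff smult_r_distr)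
  qed
  moreover have "e \<odot>\<^bsub>M\<^esub> x \<in> W" if "x \<in> W" for x
    using W e that by (auto simp: submodule_iff)
  \<comment> \<open>C may stick out of the socle, whereas the generated submodule is formed inside
    the socle; hence the intersection with \<open>W\<close>.\<close>
  ultimately have "(\<lambda>x. e \<odot>\<^bsub>M\<^esub> x) ` W \<subseteq> C \<inter> W"
    by auto
  then have "submodule_gen A (soc A M) ((\<lambda>x. e \<odot>\<^bsub>M\<^esub> x) ` W) \<subseteq> C \<inter> W"
    using submodule_Int[OF C(1) W] W
    by (intro submodule_gen_least) (auto simp: soc_W submodule_submodule_iff)
  \<comment> \<open>The hypothesis on the socle is an equation of records; comparing carriers says
    that \<open>W\<close> is generated by its multiples by e.\<close>
  moreover have "W = submodule_gen A (soc A M) ((\<lambda>x. e \<odot>\<^bsub>M\<^esub> x) ` W)"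
    using arg_cong[OF soc, of carrier] by (simp add: carrier_t_obj) (simp add: soc_W)
  ultimately have "W \<subseteq> C"
    by auto
  then have "S \<subseteq> C"
    using simple_submodule_subset_soc[OF S] by (auto simp: W_def)
  then show False
    using C(2) S simple_submodule_iff[OF M S(1)] by auto
qed

section \<open>Finite-dimensional modules have simple submodules\<close>

text \<open>Adding one vector at a time makes the spans of the tails of the list a flag. Over a
  field, each of its steps has dimension at most one.\<close>

primrec list_span :: "('k, 'z) ring_scheme \<Rightarrow> ('k, 'v) module \<Rightarrow> 'v list \<Rightarrow> 'v set" where
  "list_span K V [] = {\<zero>\<^bsub>V\<^esub>}"
| "list_span K V (b # bs) = {k \<odot>\<^bsub>V\<^esub> b \<oplus>\<^bsub>V\<^esub> v | k v. k \<in> carrier K \<and> v \<in> list_span K V bs}"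

text \<open>
  Over a field, this is the dimension of the intersection of \<open>N\<close> with the span of the list; counting the
  steps of the flag of spans at which the intersection grows avoids choosing bases.
\<close>

primrec pivot_count :: "('k, 'z) ring_scheme \<Rightarrow> ('k, 'v) module \<Rightarrow> 'v set \<Rightarrow> 'v list \<Rightarrow> nat" where
  "pivot_count K V N [] = 0"
| "pivot_count K V N (b # bs) = pivot_count K V N bs +
     (if N \<inter> list_span K V (b # bs) \<subseteq> list_span K V bs then 0 else 1)"

text \<open>Here the scalars \<open>K\<close> themselves are the ring of the module calculus, so the
  lemmas on submodules also serve for subspaces.\<close>

lemma submodule_list_span:
  assumes V: "left_module K V" and bs: "set bs \<subseteq> carrier V"
  shows "submodule (list_span K V bs) K V"
  using bs
proof (induction bs)
  case Nil
  interpret left_module K V by (rule V)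
  show ?case by (simp add: submodule_singleton_zero)
next
  case (Cons b bs)
  interpret left_module K V by (rule V)
  have b: "b \<in> carrier V" and IH: "submodule (list_span K V bs) K V"
    using Cons by auto
  have sub: "list_span K V bs \<subseteq> carrier V"
    using IH by (simp add: submodule_iff)
  show ?case
    unfolding submodule_iff
  proof (intro conjI ballI)
    show "list_span K V (b # bs) \<subseteq> carrier V"
      using b sub by auto
    have "\<zero>\<^bsub>V\<^esub> = \<zero>\<^bsub>K\<^esub> \<odot>\<^bsub>V\<^esub> b \<oplus>\<^bsub>V\<^esub> \<zero>\<^bsub>V\<^esub>"
      using b by (simp add: zero_smult)
    then show "\<zero>\<^bsub>V\<^esub> \<in> list_span K V (b # bs)"
      using IH A.zero_closed by (fastforce simp: submodule_iff)
  next
    fix x y assume "x \<in> list_span K V (b # bs)" "y \<in> list_span K V (b # bs)"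
    then obtain k l v w where *: "k \<in> carrier K" "l \<in> carrier K" "v \<in> list_span K V bs"
        "w \<in> list_span K V bs" "x = k \<odot>\<^bsub>V\<^esub> b \<oplus>\<^bsub>V\<^esub> v" "y = l \<odot>\<^bsub>V\<^esub> b \<oplus>\<^bsub>V\<^esub> w"
      by auto
    then have "x \<oplus>\<^bsub>V\<^esub> y = (k \<oplus>\<^bsub>K\<^esub> l) \<odot>\<^bsub>V\<^esub> b \<oplus>\<^bsub>V\<^esub> (v \<oplus>\<^bsub>V\<^esub> w)"
      using b sub by (simp add: subset_iff smult_l_distr M.a_ac)
    moreover have "v \<oplus>\<^bsub>V\<^esub> w \<in> list_span K V bs"
      using IH * by (simp add: submodule_iff)
    ultimately show "x \<oplus>\<^bsub>V\<^esub> y \<in> list_span K V (b # bs)"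
      using A.a_closed[OF *(1,2)] by auto
  next
    fix a x assume "a \<in> carrier K" "x \<in> list_span K V (b # bs)"
    then obtain k v where *: "a \<in> carrier K" "k \<in> carrier K" "v \<in> list_span K V bs"
        "x = k \<odot>\<^bsub>V\<^esub> b \<oplus>\<^bsub>V\<^esub> v"
      by auto
    then have "a \<odot>\<^bsub>V\<^esub> x = (a \<otimes>\<^bsub>K\<^esub> k) \<odot>\<^bsub>V\<^esub> b \<oplus>\<^bsub>V\<^esub> a \<odot>\<^bsub>V\<^esub> v"
      using b sub by (simp add: subset_iff smult_r_distr smult_assoc)
    moreover have "a \<odot>\<^bsub>V\<^esub> v \<in> list_span K V bs"
      using IH * by (simp add: submodule_iff)
    ultimately show "a \<odot>\<^bsub>V\<^esub> x \<in> list_span K V (b # bs)"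
      using A.m_closed[OF *(1,2)] by auto
  qed
qed

text \<open>This links the linear combinations over a set in \<open>fin_dim\<close> with the
  recursion on lists. Distinctness keeps the head out of the remaining sum.\<close>

lemma finsum_in_list_span:
  assumes V: "left_module K V" and "distinct bs" "set bs \<subseteq> carrier V" "c \<in> set bs \<rightarrow> carrier K"
  shows "(\<Oplus>\<^bsub>V\<^esub>b\<in>set bs. c b \<odot>\<^bsub>V\<^esub> b) \<in> list_span K V bs"
  using assms(2-)
proof (induction bs)
  case Nil
  interpret left_module K V by (rule V)
  show ?case by simp
next
  case (Cons b bs)
  interpret left_module K V by (rule V)
  have "(\<lambda>b. c b \<odot>\<^bsub>V\<^esub> b) \<in> set bs \<rightarrow> carrier V" "c b \<odot>\<^bsub>V\<^esub> b \<in> carrier V"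
    using Cons.prems by (auto simp: Pi_def subset_iff)
  then have "(\<Oplus>\<^bsub>V\<^esub>b\<in>set (b # bs). c b \<odot>\<^bsub>V\<^esub> b) = c b \<odot>\<^bsub>V\<^esub> b \<oplus>\<^bsub>V\<^esub> (\<Oplus>\<^bsub>V\<^esub>b\<in>set bs. c b \<odot>\<^bsub>V\<^esub> b)"
    using Cons.prems by simp
  then show ?case
    using Cons by auto
qed

text \<open>Every step of the flag at which \<open>N\<close> grows is one at which \<open>N'\<close>
  grows. If the counts agree, the steps are the same, and Gaussian elimination applies: at such a
  step \<open>N\<close> has a vector with nonzero leading coefficient, and subtracting a multiple of
  it moves a given vector of \<open>N'\<close> into the previous span.\<close>

lemma pivot_count_mono:
  assumes K: "field K" and V: "left_module K V" and bs: "set bs \<subseteq> carrier V"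
    and N: "submodule N K V" and N': "submodule N' K V" and sub: "N \<subseteq> N'"
  shows "pivot_count K V N bs \<le> pivot_count K V N' bs"
    and "pivot_count K V N bs = pivot_count K V N' bs \<Longrightarrow> N' \<inter> list_span K V bs \<subseteq> N"
proof -
  interpret K: field K by (rule K)
  interpret left_module K V by (rule V)
  have "pivot_count K V N bs \<le> pivot_count K V N' bs \<and>
    (pivot_count K V N bs = pivot_count K V N' bs \<longrightarrow> N' \<inter> list_span K V bs \<subseteq> N)"
    using bs
  proof (induction bs)
    case Nil
    show ?case using N by (auto simp: submodule_iff)
  next
    case (Cons b bs)
    let ?S = "list_span K V bs" and ?T = "list_span K V (b # bs)"
    have b: "b \<in> carrier V" and S: "submodule ?S K V"
      using Cons.prems submodule_list_span[OF V, of bs] by auto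
    have carr: "?S \<subseteq> carrier V" "N' \<subseteq> carrier V" "N \<subseteq> carrier V"
      using S N N' by (auto simp: submodule_iff)
    have le: "pivot_count K V N bs \<le> pivot_count K V N' bs"
      and IH: "pivot_count K V N bs = pivot_count K V N' bs \<Longrightarrow> N' \<inter> ?S \<subseteq> N"
      using Cons by auto
    have grow: "N' \<inter> ?T \<subseteq> ?S \<Longrightarrow> N \<inter> ?T \<subseteq> ?S"
      using sub by blast
    have "v \<in> N" if eq: "pivot_count K V N (b # bs) = pivot_count K V N' (b # bs)"
      and v: "v \<in> N'" "v \<in> ?T" for v
    proof -
      \<comment> \<open>Both the count over the tail and the increment for \<open>N\<close> are at
        most those for \<open>N'\<close>, so equal totals force equality in each.\<close>
      have "pivot_count K V N bs = pivot_count K V N' bs"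
        and iff: "N \<inter> ?T \<subseteq> ?S \<longleftrightarrow> N' \<inter> ?T \<subseteq> ?S"
        using eq le grow by (auto simp del: list_span.simps split: if_splits)
      then have N'S: "N' \<inter> ?S \<subseteq> N"
        using IH by auto
      show ?thesis
      proof (cases "N' \<inter> ?T \<subseteq> ?S")
        case True
        then show ?thesis using v N'S by blast
      next
        case False
        \<comment> \<open>\<open>N'\<close> grows at this step, hence so does \<open>N\<close>:
          \<open>w\<close> is the pivot vector.\<close>
        then obtain w where w: "w \<in> N" "w \<in> ?T" "w \<notin> ?S"
          using iff by blast
        obtain c w' where cw: "c \<in> carrier K" "w' \<in> ?S" "w = c \<odot>\<^bsub>V\<^esub> b \<oplus>\<^bsub>V\<^esub> w'"
          using w(2) by auto
        obtain d v' where dv: "d \<in> carrier K" "v' \<in> ?S" "v = d \<odot>\<^bsub>V\<^esub> b \<oplus>\<^bsub>V\<^esub> v'"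
          using v(2) by auto
        have "c \<noteq> \<zero>\<^bsub>K\<^esub>"
          using w(3) cw b carr by (auto simp: zero_smult subset_iff)
        then have inv: "inv\<^bsub>K\<^esub> c \<in> carrier K" "inv\<^bsub>K\<^esub> c \<otimes>\<^bsub>K\<^esub> c = \<one>\<^bsub>K\<^esub>"
          using cw(1) K.field_Units by auto
        \<comment> \<open>With this factor \<open>k w\<close> has the same coefficient
          \<open>d\<close> at \<open>b\<close> as \<open>v\<close>; dividing by \<open>c\<close> is
          where the field is used.\<close>
        define k where "k = d \<otimes>\<^bsub>K\<^esub> inv\<^bsub>K\<^esub> c"
        have k: "k \<in> carrier K" "k \<otimes>\<^bsub>K\<^esub> c = d"
          using inv cw(1) dv(1) by (simp_all add: k_def K.m_assoc)
        have kw: "k \<odot>\<^bsub>V\<^esub> w = d \<odot>\<^bsub>V\<^esub> b \<oplus>\<^bsub>V\<^esub> k \<odot>\<^bsub>V\<^esub> w'"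
          using k cw b carr smult_assoc[OF k(1) cw(1) b] by (simp add: smult_r_distr subset_iff)
        have kN: "k \<odot>\<^bsub>V\<^esub> w \<in> N"
          using N w(1) k(1) by (simp add: submodule_iff)
        have kS: "k \<odot>\<^bsub>V\<^esub> w' \<in> ?S"
          using S cw(2) k(1) by (simp add: submodule_iff)
        have in_carr: "d \<odot>\<^bsub>V\<^esub> b \<in> carrier V" "v' \<in> carrier V" "k \<odot>\<^bsub>V\<^esub> w' \<in> carrier V"
          using dv b carr kS by auto
        \<comment> \<open>The multiples of \<open>b\<close> cancel, which leaves a difference of two
          vectors of the previous span.\<close>
        have "v \<ominus>\<^bsub>V\<^esub> k \<odot>\<^bsub>V\<^esub> w = (d \<odot>\<^bsub>V\<^esub> b \<oplus>\<^bsub>V\<^esub> v') \<oplus>\<^bsub>V\<^esub> (\<ominus>\<^bsub>V\<^esub> (d \<odot>\<^bsub>V\<^esub> b) \<oplus>\<^bsub>V\<^esub> \<ominus>\<^bsub>V\<^esub> (k \<odot>\<^bsub>V\<^esub> w'))"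
          unfolding kw dv(3) using in_carr by (simp add: a_minus_def M.minus_add)
        also have "\<dots> = v' \<ominus>\<^bsub>V\<^esub> k \<odot>\<^bsub>V\<^esub> w'"
          using in_carr M.a_comm[of "d \<odot>\<^bsub>V\<^esub> b" v']
          by (simp add: a_minus_def M.a_assoc M.r_neg2)
        finally have "v \<ominus>\<^bsub>V\<^esub> k \<odot>\<^bsub>V\<^esub> w \<in> ?S"
          using submodule_minus_closed[OF S dv(2) kS] by simp
        moreover have "v \<ominus>\<^bsub>V\<^esub> k \<odot>\<^bsub>V\<^esub> w \<in> N'"
          using submodule_minus_closed[OF N' v(1)] kN sub by auto
        ultimately have "v \<ominus>\<^bsub>V\<^esub> k \<odot>\<^bsub>V\<^esub> w \<in> N"
          using N'S by blast
        then have "(v \<ominus>\<^bsub>V\<^esub> k \<odot>\<^bsub>V\<^esub> w) \<oplus>\<^bsub>V\<^esub> k \<odot>\<^bsub>V\<^esub> w \<in> N"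
          using N kN by (simp add: submodule_iff)
        moreover have "(v \<ominus>\<^bsub>V\<^esub> k \<odot>\<^bsub>V\<^esub> w) \<oplus>\<^bsub>V\<^esub> k \<odot>\<^bsub>V\<^esub> w = v"
          using kN v(1) carr by (simp add: a_minus_def M.a_assoc M.l_neg subset_iff)
        ultimately show ?thesis by simp
      qed
    qed
    then have "pivot_count K V N (b # bs) = pivot_count K V N' (b # bs) \<longrightarrow> N' \<inter> ?T \<subseteq> N"
      by blast
    moreover have "pivot_count K V N (b # bs) \<le> pivot_count K V N' (b # bs)"
      using le grow by (simp del: list_span.simps)
    ultimately show ?case by blast
  qed
  then show "pivot_count K V N bs \<le> pivot_count K V N' bs"
    "pivot_count K V N bs = pivot_count K V N' bs \<Longrightarrow> N' \<inter> list_span K V bs \<subseteq> N"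
    by auto
qed

section \<open>Restriction of scalars from A to K\<close>

lemma restrict_scalars_sel [simp]:
  "\<zero>\<^bsub>restrict_scalars A M\<^esub> = \<zero>\<^bsub>M\<^esub>"
  "x \<oplus>\<^bsub>restrict_scalars A M\<^esub> y = x \<oplus>\<^bsub>M\<^esub> y"
  by (simp_all add: restrict_scalars_def)

context assoc_algebra
begin

lemma scalar_closed: "k \<in> carrier K \<Longrightarrow> k \<odot>\<^bsub>A\<^esub> \<one>\<^bsub>A\<^esub> \<in> carrier A"
  by simp

lemma scalar_mult:
  "k \<in> carrier K \<Longrightarrow> l \<in> carrier K \<Longrightarrow>
    (k \<otimes>\<^bsub>K\<^esub> l) \<odot>\<^bsub>A\<^esub> \<one>\<^bsub>A\<^esub> = (k \<odot>\<^bsub>A\<^esub> \<one>\<^bsub>A\<^esub>) \<otimes>\<^bsub>A\<^esub> (l \<odot>\<^bsub>A\<^esub> \<one>\<^bsub>A\<^esub>)"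
  by (simp add: smult_mult_left smult_assoc1)

text \<open>Both sides equal ka. Centrality is what makes a K-multiple of an A-linear map A-linear
  again.\<close>

lemma scalar_central:
  "k \<in> carrier K \<Longrightarrow> a \<in> carrier A \<Longrightarrow>
    (k \<odot>\<^bsub>A\<^esub> \<one>\<^bsub>A\<^esub>) \<otimes>\<^bsub>A\<^esub> a = a \<otimes>\<^bsub>A\<^esub> (k \<odot>\<^bsub>A\<^esub> \<one>\<^bsub>A\<^esub>)"
  by (simp add: smult_mult_left smult_mult_right)

lemma left_module_restrict_scalars:
  assumes "left_module A M"
  shows "left_module K (restrict_scalars A M)"
proof -
  interpret M: left_module A M by (rule assms)
  have "abelian_group (restrict_scalars A M)"
    by (rule abelian_groupI) (auto simp: M.a_ac intro!: bexI[of _ "\<ominus>\<^bsub>M\<^esub> _"] M.l_neg)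
  then show ?thesis
    by (intro left_module.intro left_module_axioms.intro)
       (auto simp: M.smult_r_distr M.smult_l_distr M.smult_assoc smult_l_distr scalar_mult
         intro: R.ring_axioms)
qed

text \<open>This makes A-submodules accessible to \<open>pivot_count\<close>, which is formulated
  over K.\<close>

lemma submodule_restrict_scalars:
  assumes "left_module A M" "submodule N A M"
  shows "submodule N K (restrict_scalars A M)"
  using assms(2) left_module_restrict_scalars[OF assms(1)] assms(1)
  by (auto simp: left_module.submodule_iff)

end

text \<open>A nonzero submodule of \<open>N\<close> with least pivot count is simple: a nonzero
  submodule of it has the same count, and over a spanning list equal counts together with inclusion
  mean equality.\<close>

lemma simple_submodule_exists:
  assumes K: "field K" and alg: "assoc_algebra K A" and fd: "fd_module K A M"
    and N: "submodule N A M" "N \<noteq> {\<zero>\<^bsub>M\<^esub>}"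
  obtains S where "submodule S A M" "simple_module A (M\<lparr>carrier := S\<rparr>)" "S \<subseteq> N"
proof -
  have M: "left_module A M" and "fin_dim K (restrict_scalars A M)"
    using fd by (auto simp: fd_module_def)
  interpret A: assoc_algebra K A by (rule alg)
  interpret left_module A M by (rule M)
  define V where "V = restrict_scalars A M"
  have V: "left_module K V"
    unfolding V_def by (rule A.left_module_restrict_scalars[OF M])
  have VM: "carrier V = carrier M"
    by (simp add: V_def)
  have sub: "submodule U K V" if "submodule U A M" for U
    unfolding V_def by (rule A.submodule_restrict_scalars[OF M that])
  obtain B where B: "finite B" "B \<subseteq> carrier V"
    "\<forall>v\<in>carrier V. \<exists>c\<in>B \<rightarrow> carrier K. v = (\<Oplus>\<^bsub>V\<^esub>b\<in>B. c b \<odot>\<^bsub>V\<^esub> b)"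
    using \<open>fin_dim K (restrict_scalars A M)\<close>[folded V_def, unfolded fin_dim_def] by blast
  obtain bs where bs: "set bs = B" "distinct bs"
    using finite_distinct_list[OF B(1)] by blast
  have span: "carrier M \<subseteq> list_span K V bs"
  proof
    fix v assume "v \<in> carrier M"
    then obtain c where "c \<in> B \<rightarrow> carrier K" "v = (\<Oplus>\<^bsub>V\<^esub>b\<in>B. c b \<odot>\<^bsub>V\<^esub> b)"
      using B(3) VM by blast
    then show "v \<in> list_span K V bs"
      using finsum_in_list_span[OF V bs(2), of c] bs(1) B(2) by simp
  qed
  define P where "P U \<longleftrightarrow> submodule U A M \<and> U \<noteq> {\<zero>\<^bsub>M\<^esub>} \<and> U \<subseteq> N" for U
  have "P N"
    using N by (simp add: P_def)
  then obtain S where S: "P S" "\<And>U. P U \<Longrightarrow> pivot_count K V S bs \<le> pivot_count K V U bs"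
    using ex_has_least_nat[of P N "\<lambda>U. pivot_count K V U bs"] by blast
  have SM: "submodule S A M"
    using S(1) by (simp add: P_def)
  have "U = S" if U: "submodule U A M" "U \<subseteq> S" "U \<noteq> {\<zero>\<^bsub>M\<^esub>}" for U
  proof -
    have "P U"
      using U S(1) by (auto simp: P_def)
    then have "pivot_count K V U bs = pivot_count K V S bs"
      using S(2) pivot_count_mono(1)[OF K V _ sub[OF U(1)] sub[OF SM] U(2), of bs] bs(1) B(2)
      by (simp add: le_antisym)
    \<comment> \<open>The list spans all of M, so this intersection is \<open>S\<close>
      itself.\<close>
    then have "S \<inter> list_span K V bs \<subseteq> U"
      using pivot_count_mono(2)[OF K V _ sub[OF U(1)] sub[OF SM] U(2), of bs] bs(1) B(2) by simp
    then show ?thesis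
      using U(2) SM span by (auto simp: submodule_iff)
  qed
  then have "simple_module A (M\<lparr>carrier := S\<rparr>)"
    using S(1) unfolding simple_submodule_iff[OF M SM] P_def by blast
  then show thesis
    using that SM S(1) by (auto simp: P_def)
qed

section \<open>Homomorphisms and endomorphism algebras\<close>

lemma (in left_module) smult_uminus:
  "a \<in> carrier A \<Longrightarrow> x \<in> carrier M \<Longrightarrow> a \<odot>\<^bsub>M\<^esub> (\<ominus>\<^bsub>M\<^esub> x) = \<ominus>\<^bsub>M\<^esub> (a \<odot>\<^bsub>M\<^esub> x)"
  using smult_r_distr[of a "\<ominus>\<^bsub>M\<^esub> x" x]
  by (simp add: smult_zero M.l_neg M.minus_equality)

lemma lin_hom_closed: "h \<in> lin_hom A M N \<Longrightarrow> x \<in> carrier M \<Longrightarrow> h x \<in> carrier N"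
  by (auto simp: lin_hom_def)

lemma lin_hom_add:
  "h \<in> lin_hom A M N \<Longrightarrow> x \<in> carrier M \<Longrightarrow> y \<in> carrier M \<Longrightarrow> h (x \<oplus>\<^bsub>M\<^esub> y) = h x \<oplus>\<^bsub>N\<^esub> h y"
  by (auto simp: lin_hom_def)

lemma lin_hom_smult:
  "h \<in> lin_hom A M N \<Longrightarrow> a \<in> carrier A \<Longrightarrow> x \<in> carrier M \<Longrightarrow> h (a \<odot>\<^bsub>M\<^esub> x) = a \<odot>\<^bsub>N\<^esub> h x"
  by (auto simp: lin_hom_def)

lemma lin_hom_eqI:
  "f \<in> lin_hom A M N \<Longrightarrow> g \<in> lin_hom A M N \<Longrightarrow> (\<And>x. x \<in> carrier M \<Longrightarrow> f x = g x) \<Longrightarrow> f = g"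
  by (auto simp: lin_hom_def intro: PiE_ext)

lemma restrict_in_lin_hom:
  assumes "left_module A M"
    and "\<And>x. x \<in> carrier M \<Longrightarrow> h x \<in> carrier N"
    and "\<And>x y. x \<in> carrier M \<Longrightarrow> y \<in> carrier M \<Longrightarrow> h (x \<oplus>\<^bsub>M\<^esub> y) = h x \<oplus>\<^bsub>N\<^esub> h y"
    and "\<And>a x. a \<in> carrier A \<Longrightarrow> x \<in> carrier M \<Longrightarrow> h (a \<odot>\<^bsub>M\<^esub> x) = a \<odot>\<^bsub>N\<^esub> h x"
  shows "restrict h (carrier M) \<in> lin_hom A M N"
proof -
  interpret left_module A M by (rule assms(1))
  show ?thesis
    using assms(2-) by (simp add: lin_hom_def)
qed

lemma lin_hom_zero:
  assumes "left_module A M" "left_module A N" "h \<in> lin_hom A M N"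
  shows "h \<zero>\<^bsub>M\<^esub> = \<zero>\<^bsub>N\<^esub>"
proof -
  interpret M: left_module A M by (rule assms(1))
  interpret N: left_module A N by (rule assms(2))
  have "h \<zero>\<^bsub>M\<^esub> = h (\<zero>\<^bsub>A\<^esub> \<odot>\<^bsub>M\<^esub> \<zero>\<^bsub>M\<^esub>)"
    by (simp add: M.smult_zero)
  also have "\<dots> = \<zero>\<^bsub>N\<^esub>"
    by (simp add: lin_hom_smult[OF assms(3)] lin_hom_closed[OF assms(3)] N.zero_smult)
  finally show ?thesis .
qed

section \<open>The endomorphism algebra\<close>

text \<open>\<open>assoc_algebra_hom\<close> demands that its source and target are algebras. The
  laws hold pointwise, and \<open>lin_hom_eqI\<close> lifts them to functions once closure is
  known.\<close>

lemma assoc_algebra_End_alg: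
  assumes alg: "assoc_algebra K A" and M: "left_module A M"
  shows "assoc_algebra K (End_alg A M)"
proof -
  interpret A: assoc_algebra K A by (rule alg)
  interpret M: left_module A M by (rule M)
  note hom = lin_hom_closed[of _ A M M] lin_hom_add[of _ A M M] lin_hom_smult[of _ A M M]
  let ?E = "End_alg A M"
  have carrier: "carrier ?E = lin_hom A M M"
    by (simp add: End_alg_def)
  have add: "f \<oplus>\<^bsub>?E\<^esub> g = (\<lambda>x\<in>carrier M. f x \<oplus>\<^bsub>M\<^esub> g x)" for f g
    by (simp add: End_alg_def)
  have zero: "\<zero>\<^bsub>?E\<^esub> = (\<lambda>x\<in>carrier M. \<zero>\<^bsub>M\<^esub>)"
    by (simp add: End_alg_def)
  have mult: "f \<otimes>\<^bsub>?E\<^esub> g = (\<lambda>x\<in>carrier M. f (g x))" for f g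
    by (simp add: End_alg_def compose_def)
  have one: "\<one>\<^bsub>?E\<^esub> = (\<lambda>x\<in>carrier M. x)"
    by (simp add: End_alg_def)
  have smult: "k \<odot>\<^bsub>?E\<^esub> f = (\<lambda>x\<in>carrier M. (k \<odot>\<^bsub>A\<^esub> \<one>\<^bsub>A\<^esub>) \<odot>\<^bsub>M\<^esub> f x)" for k f
    by (simp add: End_alg_def)
  have add_closed: "f \<oplus>\<^bsub>?E\<^esub> g \<in> lin_hom A M M" if "f \<in> lin_hom A M M" "g \<in> lin_hom A M M" for f g
    unfolding add using that by (intro restrict_in_lin_hom M) (auto simp: hom M.a_ac M.smult_r_distr)
  have zero_closed: "\<zero>\<^bsub>?E\<^esub> \<in> lin_hom A M M"
    unfolding zero by (intro restrict_in_lin_hom M) (auto simp: M.smult_zero)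
  have mult_closed: "f \<otimes>\<^bsub>?E\<^esub> g \<in> lin_hom A M M" if "f \<in> lin_hom A M M" "g \<in> lin_hom A M M" for f g
    unfolding mult using that by (intro restrict_in_lin_hom M) (auto simp: hom)
  have one_closed: "\<one>\<^bsub>?E\<^esub> \<in> lin_hom A M M"
    unfolding one by (intro restrict_in_lin_hom M) auto
  have smult_closed: "k \<odot>\<^bsub>?E\<^esub> f \<in> lin_hom A M M" if k: "k \<in> carrier K" and f: "f \<in> lin_hom A M M" for k f
    unfolding smult
  proof (intro restrict_in_lin_hom M)
    \<comment> \<open>For k f to commute with the action of a, the element k1 must move past a,
      which is centrality.\<close>
    fix a x assume "a \<in> carrier A" "x \<in> carrier M"
    then show "(k \<odot>\<^bsub>A\<^esub> \<one>\<^bsub>A\<^esub>) \<odot>\<^bsub>M\<^esub> f (a \<odot>\<^bsub>M\<^esub> x) = a \<odot>\<^bsub>M\<^esub> ((k \<odot>\<^bsub>A\<^esub> \<one>\<^bsub>A\<^esub>) \<odot>\<^bsub>M\<^esub> f x)"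
      using k f A.scalar_closed[OF k]
      by (simp only: hom M.smult_assoc[symmetric] A.scalar_central)
  qed (use k f in \<open>auto simp: hom M.smult_r_distr\<close>)
  have uminus: "\<exists>g\<in>lin_hom A M M. g \<oplus>\<^bsub>?E\<^esub> f = \<zero>\<^bsub>?E\<^esub>" if f: "f \<in> lin_hom A M M" for f
  proof
    show g: "(\<lambda>x\<in>carrier M. \<ominus>\<^bsub>M\<^esub> f x) \<in> lin_hom A M M"
      using f by (intro restrict_in_lin_hom M) (auto simp: hom M.minus_add M.smult_uminus)
    show "(\<lambda>x\<in>carrier M. \<ominus>\<^bsub>M\<^esub> f x) \<oplus>\<^bsub>?E\<^esub> f = \<zero>\<^bsub>?E\<^esub>"
      by (rule lin_hom_eqI[OF add_closed[OF g f] zero_closed]) (simp add: add zero lin_hom_closed[OF f] M.l_neg)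
  qed
  have ab: "abelian_group ?E"
  proof (rule abelian_groupI, unfold carrier)
    fix f g h assume fgh: "f \<in> lin_hom A M M" "g \<in> lin_hom A M M" "h \<in> lin_hom A M M"
    show "(f \<oplus>\<^bsub>?E\<^esub> g) \<oplus>\<^bsub>?E\<^esub> h = f \<oplus>\<^bsub>?E\<^esub> (g \<oplus>\<^bsub>?E\<^esub> h)"
      using fgh by (intro lin_hom_eqI[of _ A M M] add_closed) (auto simp: add hom M.a_assoc)
  next
    fix f g assume fg: "f \<in> lin_hom A M M" "g \<in> lin_hom A M M"
    then show "f \<oplus>\<^bsub>?E\<^esub> g = g \<oplus>\<^bsub>?E\<^esub> f"
      by (intro lin_hom_eqI[OF add_closed add_closed]) (auto simp: add hom M.a_comm)
  next
    fix f assume f: "f \<in> lin_hom A M M"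
    then show "\<zero>\<^bsub>?E\<^esub> \<oplus>\<^bsub>?E\<^esub> f = f"
      by (intro lin_hom_eqI[OF add_closed[OF zero_closed f] f]) (simp add: add zero hom)
  qed (auto intro: add_closed zero_closed uminus)
  have monoid: "monoid ?E"
  proof (rule monoidI, unfold carrier)
    fix f g h assume fgh: "f \<in> lin_hom A M M" "g \<in> lin_hom A M M" "h \<in> lin_hom A M M"
    show "(f \<otimes>\<^bsub>?E\<^esub> g) \<otimes>\<^bsub>?E\<^esub> h = f \<otimes>\<^bsub>?E\<^esub> (g \<otimes>\<^bsub>?E\<^esub> h)"
      using fgh by (intro lin_hom_eqI[of _ A M M] mult_closed) (auto simp: mult hom)
  next
    fix f assume f: "f \<in> lin_hom A M M"
    show "\<one>\<^bsub>?E\<^esub> \<otimes>\<^bsub>?E\<^esub> f = f"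
      by (rule lin_hom_eqI[OF mult_closed[OF one_closed f] f]) (simp add: mult one hom f)
    show "f \<otimes>\<^bsub>?E\<^esub> \<one>\<^bsub>?E\<^esub> = f"
      by (rule lin_hom_eqI[OF mult_closed[OF f one_closed] f]) (simp add: mult one hom f)
  qed (auto intro: mult_closed one_closed)
  have ring: "ring ?E"
  proof (rule ringI[OF ab monoid], unfold carrier)
    fix f g h assume fgh: "f \<in> lin_hom A M M" "g \<in> lin_hom A M M" "h \<in> lin_hom A M M"
    show "(f \<oplus>\<^bsub>?E\<^esub> g) \<otimes>\<^bsub>?E\<^esub> h = f \<otimes>\<^bsub>?E\<^esub> h \<oplus>\<^bsub>?E\<^esub> g \<otimes>\<^bsub>?E\<^esub> h"
      using fgh by (intro lin_hom_eqI[of _ A M M] mult_closed add_closed) (auto simp: mult add hom)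
    show "h \<otimes>\<^bsub>?E\<^esub> (f \<oplus>\<^bsub>?E\<^esub> g) = h \<otimes>\<^bsub>?E\<^esub> f \<oplus>\<^bsub>?E\<^esub> h \<otimes>\<^bsub>?E\<^esub> g"
      using fgh by (intro lin_hom_eqI[of _ A M M] mult_closed add_closed) (auto simp: mult add hom)
  qed
  have module: "module K ?E"
  proof (rule moduleI[OF A.R.cring_axioms ab], unfold carrier)
    fix k l f assume klf: "k \<in> carrier K" "l \<in> carrier K" "f \<in> lin_hom A M M"
    show "(k \<oplus>\<^bsub>K\<^esub> l) \<odot>\<^bsub>?E\<^esub> f = k \<odot>\<^bsub>?E\<^esub> f \<oplus>\<^bsub>?E\<^esub> l \<odot>\<^bsub>?E\<^esub> f"
      using klf by (intro lin_hom_eqI[of _ A M M] smult_closed add_closed)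
        (auto simp: smult add hom A.smult_l_distr M.smult_l_distr)
    show "(k \<otimes>\<^bsub>K\<^esub> l) \<odot>\<^bsub>?E\<^esub> f = k \<odot>\<^bsub>?E\<^esub> (l \<odot>\<^bsub>?E\<^esub> f)"
      using klf by (intro lin_hom_eqI[of _ A M M] smult_closed)
        (auto simp: smult hom A.scalar_mult M.smult_assoc)
  next
    fix k f g assume kfg: "k \<in> carrier K" "f \<in> lin_hom A M M" "g \<in> lin_hom A M M"
    show "k \<odot>\<^bsub>?E\<^esub> (f \<oplus>\<^bsub>?E\<^esub> g) = k \<odot>\<^bsub>?E\<^esub> f \<oplus>\<^bsub>?E\<^esub> k \<odot>\<^bsub>?E\<^esub> g"
      using kfg by (intro lin_hom_eqI[of _ A M M] smult_closed add_closed)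
        (auto simp: smult add hom M.smult_r_distr)
  next
    fix f assume f: "f \<in> lin_hom A M M"
    show "\<one>\<^bsub>K\<^esub> \<odot>\<^bsub>?E\<^esub> f = f"
      using f by (intro lin_hom_eqI[of _ A M M] smult_closed) (auto simp: smult hom)
  qed (auto intro: smult_closed)
  show ?thesis
  proof (intro assoc_algebra.intro assoc_algebra_axioms.intro module ring, unfold carrier)
    fix k f g assume kfg: "k \<in> carrier K" "f \<in> lin_hom A M M" "g \<in> lin_hom A M M"
    show "(k \<odot>\<^bsub>?E\<^esub> f) \<otimes>\<^bsub>?E\<^esub> g = k \<odot>\<^bsub>?E\<^esub> (f \<otimes>\<^bsub>?E\<^esub> g)"
      using kfg by (intro lin_hom_eqI[of _ A M M] smult_closed mult_closed) (auto simp: smult mult hom)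
    show "f \<otimes>\<^bsub>?E\<^esub> (k \<odot>\<^bsub>?E\<^esub> g) = k \<odot>\<^bsub>?E\<^esub> (f \<otimes>\<^bsub>?E\<^esub> g)"
      using kfg by (intro lin_hom_eqI[of _ A M M] smult_closed mult_closed) (auto simp: smult mult hom)
  qed
qed

section \<open>Functoriality of AeM\<close>

text \<open>The preimage of AeN under \<open>h\<close> is a submodule and contains eM because h(ex)
  = e h(x); so it contains the submodule generated by eM.\<close>

lemma lin_hom_t_obj:
  assumes M: "left_module A M" and N: "left_module A N" and e: "e \<in> carrier A"
    and h: "h \<in> lin_hom A M N" and x: "x \<in> carrier (t_obj A e M)"
  shows "h x \<in> carrier (t_obj A e N)"
proof -
  interpret M: left_module A M by (rule M)
  interpret N: left_module A N by (rule N)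
  let ?T = "carrier (t_obj A e N)"
  have T: "submodule ?T A N"
    by (rule submodule_t_obj[OF N e])
  have "submodule {x \<in> carrier M. h x \<in> ?T} A M"
    using T by (simp add: M.submodule_iff N.submodule_iff lin_hom_add[OF h] lin_hom_smult[OF h] lin_hom_zero[OF M N h])
  moreover have "(\<lambda>x. e \<odot>\<^bsub>M\<^esub> x) ` carrier M \<subseteq> {x \<in> carrier M. h x \<in> ?T}"
    using e by (auto simp: lin_hom_smult[OF h] lin_hom_closed[OF h] smult_in_t_obj)
  ultimately have "carrier (t_obj A e M) \<subseteq> {x \<in> carrier M. h x \<in> ?T}"
    unfolding carrier_t_obj[of A e M] by (rule submodule_gen_least)
  then show ?thesis using x by auto
qed

text \<open>Endomorphisms preserve AeM, so composing restrictions is the same as restricting the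
  composite. Sums and scalar multiples are pointwise and restrict as well.\<close>

lemma assoc_algebra_hom_t_mor:
  assumes alg: "assoc_algebra K A" and M: "left_module A M" and e: "e \<in> carrier A"
  shows "assoc_algebra_hom K (End_alg A M) (End_alg A (t_obj A e M)) (t_mor A e M)"
proof -
  interpret A: assoc_algebra K A by (rule alg)
  interpret M: left_module A M by (rule M)
  define T where "T = carrier (t_obj A e M)"
  have t_obj: "t_obj A e M = M\<lparr>carrier := T\<rparr>"
    by (simp add: T_def t_obj_def)
  have T: "submodule T A M"
    unfolding T_def by (rule submodule_t_obj[OF M e])
  have TM: "x \<in> carrier M" if "x \<in> T" for x
    using that T by (auto simp: M.submodule_iff)
  have lmT: "left_module A (M\<lparr>carrier := T\<rparr>)"
    by (rule M.left_module_submodule[OF T])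
  have fT: "f x \<in> T" if "f \<in> lin_hom A M M" "x \<in> T" for f x
    using lin_hom_t_obj[OF M M e] that by (simp add: T_def)
  have closed: "restrict f T \<in> lin_hom A (M\<lparr>carrier := T\<rparr>) (M\<lparr>carrier := T\<rparr>)" if f: "f \<in> lin_hom A M M" for f
    using restrict_in_lin_hom[OF lmT, of f "M\<lparr>carrier := T\<rparr>"] f
    by (simp add: fT TM lin_hom_add[OF f] lin_hom_smult[OF f])
  show ?thesis
  proof (intro assoc_algebra_hom.intro assoc_algebra_hom_axioms.intro)
    show "assoc_algebra K (End_alg A M)" "assoc_algebra K (End_alg A (t_obj A e M))"
      using assoc_algebra_End_alg[OF alg M] assoc_algebra_End_alg[OF alg lmT] by (simp_all add: t_obj)
    show "t_mor A e M \<in> ring_hom (End_alg A M) (End_alg A (t_obj A e M))"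
      by (rule ring_hom_memI)
         (auto simp: t_mor_def T_def[symmetric] t_obj End_alg_def compose_def fT TM closed
           simp del: restrict_apply intro!: restrict_ext, auto simp: fT TM)
    show "t_mor A e M (k \<odot>\<^bsub>End_alg A M\<^esub> f) = k \<odot>\<^bsub>End_alg A (t_obj A e M)\<^esub> t_mor A e M f" for k f
      by (auto simp: t_mor_def T_def[symmetric] t_obj End_alg_def fun_eq_iff restrict_def TM)
  qed
qed

text \<open>The source is to be a whole direct sum, so finite dimension and the socle condition are
  asked of the target, where the image of the difference lives.\<close>

lemma lin_hom_eq_if_eq_on_t_obj:
  assumes K: "field K" and alg: "assoc_algebra K A" and e: "e \<in> carrier A"
    and M: "left_module A M" and fd: "fd_module K A N"
    and soc: "soc A N = t_obj A e (soc A N)"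
    and f: "f \<in> lin_hom A M N" and g: "g \<in> lin_hom A M N"
    and eq: "\<And>x. x \<in> carrier (t_obj A e M) \<Longrightarrow> f x = g x"
  shows "f = g"
proof -
  have N: "left_module A N"
    using fd by (simp add: fd_module_def)
  interpret M: left_module A M by (rule M)
  interpret N: left_module A N by (rule N)
  note hom = lin_hom_closed[OF f] lin_hom_closed[OF g] lin_hom_add[OF f] lin_hom_add[OF g]
    lin_hom_smult[OF f] lin_hom_smult[OF g]
  \<comment> \<open>The restriction makes the difference \<open>undefined\<close> off the carrier,
    as membership in \<open>lin_hom\<close> demands.\<close>
  define d where "d = (\<lambda>x\<in>carrier M. f x \<ominus>\<^bsub>N\<^esub> g x)"
  have d: "d \<in> lin_hom A M N"
    unfolding d_def
    by (intro restrict_in_lin_hom M)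
       (auto simp: hom a_minus_def N.minus_add N.a_ac N.smult_r_distr N.smult_uminus)
  note dhom = lin_hom_closed[OF d] lin_hom_add[OF d] lin_hom_smult[OF d]
  have image: "submodule (d ` carrier M) A N"
    unfolding N.submodule_iff
  proof (intro conjI ballI)
    show "d ` carrier M \<subseteq> carrier N"
      using dhom(1) by auto
    show "\<zero>\<^bsub>N\<^esub> \<in> d ` carrier M"
      using lin_hom_zero[OF M N d] by (intro image_eqI[of _ d "\<zero>\<^bsub>M\<^esub>"]) auto
  next
    fix u v assume "u \<in> d ` carrier M" "v \<in> d ` carrier M"
    then obtain x y where "x \<in> carrier M" "y \<in> carrier M" "u = d x" "v = d y" by auto
    then show "u \<oplus>\<^bsub>N\<^esub> v \<in> d ` carrier M"
      using dhom(2)[of x y] by (intro image_eqI[of _ d "x \<oplus>\<^bsub>M\<^esub> y"]) auto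
  next
    fix a u assume "a \<in> carrier A" "u \<in> d ` carrier M"
    then obtain x where "a \<in> carrier A" "x \<in> carrier M" "u = d x" by auto
    then show "a \<odot>\<^bsub>N\<^esub> u \<in> d ` carrier M"
      using dhom(3)[of a x] by (intro image_eqI[of _ d "a \<odot>\<^bsub>M\<^esub> x"]) auto
  qed
  have "d ` carrier M = {\<zero>\<^bsub>N\<^esub>}"
  proof (rule ccontr)
    assume "d ` carrier M \<noteq> {\<zero>\<^bsub>N\<^esub>}"
    then obtain S where S: "submodule S A N" "simple_module A (N\<lparr>carrier := S\<rparr>)" "S \<subseteq> d ` carrier M"
      using simple_submodule_exists[OF K alg fd image] by blast
    \<comment> \<open>The simple \<open>S\<close> lies in the image, so its element not killed by e
      has the form d x.\<close>
    then obtain x where x: "x \<in> carrier M" "e \<odot>\<^bsub>N\<^esub> d x \<noteq> \<zero>\<^bsub>N\<^esub>"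
      using simple_submodule_not_annihilated[OF N e soc] by blast
    have "e \<odot>\<^bsub>N\<^esub> d x = d (e \<odot>\<^bsub>M\<^esub> x)"
      using x(1) e by (simp add: dhom)
    also have "\<dots> = \<zero>\<^bsub>N\<^esub>"
      using x(1) e eq[OF smult_in_t_obj[OF x(1)]] lin_hom_closed[OF g]
      by (simp add: d_def N.r_neg a_minus_def)
    finally show False using x(2) by simp
  qed
  then have "f x \<oplus>\<^bsub>N\<^esub> \<ominus>\<^bsub>N\<^esub> g x = \<zero>\<^bsub>N\<^esub>" if "x \<in> carrier M" for x
    using that by (auto simp: d_def a_minus_def)
  then have "f x = g x" if "x \<in> carrier M" for x
    using that N.minus_equality[of "f x" "\<ominus>\<^bsub>N\<^esub> g x"] by (simp add: hom)
  then show ?thesis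
    by (rule lin_hom_eqI[OF f g])
qed

section \<open>Direct sums\<close>

text \<open>The module laws are componentwise. What needs care is finite support: a sum is supported
  in the union of two supports, and a multiple in the old support because a0 = 0.\<close>

lemma left_module_direct_sum:
  assumes A: "ring A" and M: "\<And>i. i \<in> I \<Longrightarrow> left_module A (M i)"
  shows "left_module A (direct_sum I M)"
proof -
  have ab: "abelian_group (M i)" and am: "abelian_monoid (M i)" if "i \<in> I" for i
    using M[OF that] by (auto simp: left_module_def abelian_group_def)
  let ?D = "direct_sum I M"
  have carrier: "f \<in> carrier ?D \<longleftrightarrow> f \<in> (\<Pi>\<^sub>E i\<in>I. carrier (M i)) \<and> finite {i \<in> I. f i \<noteq> \<zero>\<^bsub>M i\<^esub>}" for f
    by (simp add: direct_sum_def)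
  have add: "f \<oplus>\<^bsub>?D\<^esub> g = (\<lambda>i\<in>I. f i \<oplus>\<^bsub>M i\<^esub> g i)" for f g
    by (simp add: direct_sum_def)
  have zero: "\<zero>\<^bsub>?D\<^esub> = (\<lambda>i\<in>I. \<zero>\<^bsub>M i\<^esub>)"
    by (simp add: direct_sum_def)
  have smult: "a \<odot>\<^bsub>?D\<^esub> f = (\<lambda>i\<in>I. a \<odot>\<^bsub>M i\<^esub> f i)" for a f
    by (simp add: direct_sum_def)
  have eqI: "f = g" if "f \<in> carrier ?D" "g \<in> carrier ?D" "\<And>i. i \<in> I \<Longrightarrow> f i = g i" for f g
    using that by (auto simp: carrier intro: PiE_ext)
  have comp: "f i \<in> carrier (M i)" if "f \<in> carrier ?D" "i \<in> I" for f i
    using that by (auto simp: carrier)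
  have add_closed: "f \<oplus>\<^bsub>?D\<^esub> g \<in> carrier ?D" if fg: "f \<in> carrier ?D" "g \<in> carrier ?D" for f g
  proof -
    have "{i \<in> I. (f \<oplus>\<^bsub>?D\<^esub> g) i \<noteq> \<zero>\<^bsub>M i\<^esub>} \<subseteq> {i \<in> I. f i \<noteq> \<zero>\<^bsub>M i\<^esub>} \<union> {i \<in> I. g i \<noteq> \<zero>\<^bsub>M i\<^esub>}"
      using am by (auto simp: add abelian_monoid.l_zero abelian_monoid.zero_closed)
    then have "finite {i \<in> I. (f \<oplus>\<^bsub>?D\<^esub> g) i \<noteq> \<zero>\<^bsub>M i\<^esub>}"
      using fg by (auto simp: carrier intro: finite_subset)
    then show ?thesis
      using comp[OF fg(1)] comp[OF fg(2)] am unfolding carrier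
      by (auto simp: add abelian_monoid.a_closed)
  qed
  have zero_closed: "\<zero>\<^bsub>?D\<^esub> \<in> carrier ?D"
    using am by (auto simp: carrier zero abelian_monoid.zero_closed)
  have smult_closed: "a \<odot>\<^bsub>?D\<^esub> f \<in> carrier ?D" if a: "a \<in> carrier A" and f: "f \<in> carrier ?D" for a f
  proof -
    have "{i \<in> I. (a \<odot>\<^bsub>?D\<^esub> f) i \<noteq> \<zero>\<^bsub>M i\<^esub>} \<subseteq> {i \<in> I. f i \<noteq> \<zero>\<^bsub>M i\<^esub>}"
      using left_module.smult_zero[OF M a] by (auto simp: smult)
    then have "finite {i \<in> I. (a \<odot>\<^bsub>?D\<^esub> f) i \<noteq> \<zero>\<^bsub>M i\<^esub>}"
      using f by (auto simp: carrier intro: finite_subset)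
    then show ?thesis
      using comp[OF f] left_module.smult_closed[OF M a] unfolding carrier by (auto simp: smult)
  qed
  have abD: "abelian_group ?D"
  proof (rule abelian_groupI)
    fix f g h assume fgh: "f \<in> carrier ?D" "g \<in> carrier ?D" "h \<in> carrier ?D"
    show "(f \<oplus>\<^bsub>?D\<^esub> g) \<oplus>\<^bsub>?D\<^esub> h = f \<oplus>\<^bsub>?D\<^esub> (g \<oplus>\<^bsub>?D\<^esub> h)"
      using fgh by (intro eqI add_closed) (auto simp: add comp abelian_monoid.a_assoc[OF am])
  next
    fix f g assume fg: "f \<in> carrier ?D" "g \<in> carrier ?D"
    show "f \<oplus>\<^bsub>?D\<^esub> g = g \<oplus>\<^bsub>?D\<^esub> f"
      using fg by (intro eqI add_closed) (auto simp: add comp abelian_monoid.a_comm[OF am])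
  next
    fix f assume f: "f \<in> carrier ?D"
    show "\<zero>\<^bsub>?D\<^esub> \<oplus>\<^bsub>?D\<^esub> f = f"
      using f by (intro eqI add_closed zero_closed) (auto simp: add zero comp abelian_monoid.l_zero[OF am])
    \<comment> \<open>Taking (-1)f as the negative of f inherits finite support from closure under
      the action.\<close>
    have "(\<ominus>\<^bsub>A\<^esub> \<one>\<^bsub>A\<^esub>) \<odot>\<^bsub>?D\<^esub> f \<in> carrier ?D"
      using f A by (intro smult_closed) (auto simp: abelian_group.a_inv_closed ring.is_abelian_group monoid.one_closed ring.is_monoid)
    moreover have "(\<ominus>\<^bsub>A\<^esub> \<one>\<^bsub>A\<^esub>) \<odot>\<^bsub>?D\<^esub> f \<oplus>\<^bsub>?D\<^esub> f = \<zero>\<^bsub>?D\<^esub>"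
      using f calculation
      by (intro eqI add_closed zero_closed)
         (auto simp: add zero smult comp left_module.uminus_one_smult[OF M] abelian_group.l_neg[OF ab])
    ultimately show "\<exists>g\<in>carrier ?D. g \<oplus>\<^bsub>?D\<^esub> f = \<zero>\<^bsub>?D\<^esub>"
      by blast
  qed (auto intro: add_closed zero_closed)
  show ?thesis
  proof (intro left_module.intro A abD left_module_axioms.intro)
    fix a b f assume abf: "a \<in> carrier A" "b \<in> carrier A" "f \<in> carrier ?D"
    interpret A: ring A by (rule A)
    show "(a \<oplus>\<^bsub>A\<^esub> b) \<odot>\<^bsub>?D\<^esub> f = a \<odot>\<^bsub>?D\<^esub> f \<oplus>\<^bsub>?D\<^esub> b \<odot>\<^bsub>?D\<^esub> f"
      using abf by (intro eqI add_closed smult_closed)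
        (auto simp: add smult comp left_module.smult_l_distr[OF M])
    show "(a \<otimes>\<^bsub>A\<^esub> b) \<odot>\<^bsub>?D\<^esub> f = a \<odot>\<^bsub>?D\<^esub> (b \<odot>\<^bsub>?D\<^esub> f)"
      using abf by (intro eqI smult_closed) (auto simp: smult comp left_module.smult_assoc[OF M])
  next
    fix a f g assume afg: "a \<in> carrier A" "f \<in> carrier ?D" "g \<in> carrier ?D"
    show "a \<odot>\<^bsub>?D\<^esub> (f \<oplus>\<^bsub>?D\<^esub> g) = a \<odot>\<^bsub>?D\<^esub> f \<oplus>\<^bsub>?D\<^esub> a \<odot>\<^bsub>?D\<^esub> g"
      using afg by (intro eqI add_closed smult_closed)
        (auto simp: add smult comp left_module.smult_r_distr[OF M])
  next
    fix f assume f: "f \<in> carrier ?D"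
    interpret A: ring A by (rule A)
    show "\<one>\<^bsub>A\<^esub> \<odot>\<^bsub>?D\<^esub> f = f"
      using f by (intro eqI smult_closed) (auto simp: smult comp left_module.smult_one[OF M])
  qed (rule smult_closed)
qed

text \<open>This is \<open>f\<close> followed by the projection to the summand \<open>M i\<close>,
  restricted so as to be an element of \<open>lin_hom\<close>.\<close>

lemma lin_hom_direct_sum_component:
  assumes N: "left_module A N" and f: "f \<in> lin_hom A N (direct_sum I M)" and i: "i \<in> I"
  shows "(\<lambda>x\<in>carrier N. f x i) \<in> lin_hom A N (M i)"
proof (rule restrict_in_lin_hom[OF N])
  show "f x i \<in> carrier (M i)" if "x \<in> carrier N" for x
    using lin_hom_closed[OF f that] i by (auto simp: direct_sum_def)
qed (use i in \<open>auto simp: lin_hom_add[OF f] lin_hom_smult[OF f] direct_sum_def\<close>)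

text \<open>Projecting to each P(i) replaces a target of unknown dimension by a finite-dimensional
  one to which the socle hypothesis applies directly, so the socle of the direct sum never has to be
  determined.\<close>

theorem theorem2p4:
  fixes K :: "'k ring" and A :: "('k, 'a) module" and p :: nat
    and \<Lambda> :: "'l set" and L :: "'l \<Rightarrow> ('a, 'm) module" and P :: "'l \<Rightarrow> ('a, 'n) module"
    and e :: 'a and \<Lambda>' :: "'l set"
  assumes "algebraically_closed K" and "ring_char K = p" and "p > 0"
    and "assoc_algebra K A" and "fin_dim K A"
    and "complete_simples K A \<Lambda> L"
    and "\<And>i. i \<in> \<Lambda> \<Longrightarrow> indecomposable A (P i) \<and> (\<exists>\<pi>. projective_cover K A (P i) (L i) \<pi>)"
    and "e \<in> carrier A" and "e \<otimes>\<^bsub>A\<^esub> e = e"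
    and "projective K A (left_ideal_module A e)" and "basic_module A (left_ideal_module A e)"
    and "\<Lambda>' \<subseteq> \<Lambda>"
    and "\<And>i. i \<in> \<Lambda>' \<Longrightarrow> soc A (P i) = t_obj A e (soc A (P i))"
  shows "assoc_algebra_hom K
           (End_alg A (direct_sum \<Lambda>' P))
           (End_alg A (t_obj A e (direct_sum \<Lambda>' P)))
           (t_mor A e (direct_sum \<Lambda>' P)) \<and>
         inj_on (t_mor A e (direct_sum \<Lambda>' P)) (carrier (End_alg A (direct_sum \<Lambda>' P)))"
proof
  let ?D = "direct_sum \<Lambda>' P"
  interpret K: algebraically_closed K by (rule assms(1))
  interpret A: assoc_algebra K A by (rule assms(4))
  \<comment> \<open>Finite dimension is part of \<open>projective\<close>, so it comes with the
    projective covers.\<close>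
  have fd: "fd_module K A (P i)" if "i \<in> \<Lambda>'" for i
    using assms(7)[of i] assms(12) that by (auto simp: projective_cover_def projective_def)
  then have D: "left_module A ?D"
    by (intro left_module_direct_sum A.ring_axioms) (auto simp: fd_module_def)
  show "assoc_algebra_hom K (End_alg A ?D) (End_alg A (t_obj A e ?D)) (t_mor A e ?D)"
    by (rule assoc_algebra_hom_t_mor[OF assms(4) D assms(8)])
  show "inj_on (t_mor A e ?D) (carrier (End_alg A ?D))"
  proof (rule inj_onI)
    fix f g
    assume "f \<in> carrier (End_alg A ?D)" "g \<in> carrier (End_alg A ?D)"
      and t: "t_mor A e ?D f = t_mor A e ?D g"
    then have f: "f \<in> lin_hom A ?D ?D" and g: "g \<in> lin_hom A ?D ?D"
      by (auto simp: End_alg_def)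
    have sub: "carrier (t_obj A e ?D) \<subseteq> carrier ?D"
      using submodule_t_obj[OF D assms(8)] by (simp add: left_module.submodule_iff[OF D])
    have eq: "f x = g x" if "x \<in> carrier (t_obj A e ?D)" for x
      using fun_cong[OF t, of x] that by (simp add: t_mor_def)
    \<comment> \<open>The source stays the whole sum; only the target is cut down to one
      summand.\<close>
    have comp: "(\<lambda>x\<in>carrier ?D. f x i) = (\<lambda>x\<in>carrier ?D. g x i)" if i: "i \<in> \<Lambda>'" for i
      by (rule lin_hom_eq_if_eq_on_t_obj[OF K.field_axioms assms(4) assms(8) D fd[OF i] assms(13)[OF i]
            lin_hom_direct_sum_component[OF D f i] lin_hom_direct_sum_component[OF D g i]])
         (use eq sub in auto)
    show "f = g"
    proof (rule lin_hom_eqI[OF f g])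
      fix x assume x: "x \<in> carrier ?D"
      \<comment> \<open>Elements of the direct sum are extensional functions on the index set, so
        agreement at every index suffices.\<close>
      have "f x \<in> (\<Pi>\<^sub>E i\<in>\<Lambda>'. carrier (P i))" "g x \<in> (\<Pi>\<^sub>E i\<in>\<Lambda>'. carrier (P i))"
        using lin_hom_closed[OF f x] lin_hom_closed[OF g x] by (auto simp: direct_sum_def)
      then show "f x = g x"
        using fun_cong[OF comp, of _ x] x by (intro PiE_ext) auto
    qed
  qed
qed

end
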